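(* Let $L$ be a positive integer. Then the set $I_L(n)=\{n,n+1,\ldots,n+L-1\}$ reduces to zero for every $n\in\mathbb{Z}$ if and only if $12\mid L$ and $L\ge 24$.
   Context: For integers $a,b$, define $\mathcal{F}(a,b)=|a^{2}-b^{2}|$. A reduction step on a finite multiset $\mathcal{A}$ of integers removes two entries $a,b$ of $\mathcal{A}$ (two distinct occurrences, counted with multiplicity) and inserts $\mathcal{F}(a,b)$; thus each step decreases the size of the multiset by one. A finite (nonempty) multiset $\mathcal{A}$ of integers is said to reduce to zero if there is some sequence of reduction steps, starting from $\mathcal{A}$ and continuing until a single entry remains, for which that final entry is $0$. A finite set is regarded as a multiset in which every element has multiplicity one. *)

theory Defs
  imports Main "HOL-Library.Multiset"
begin

definition sqdiff :: "int \<Rightarrow> int \<Rightarrow> int" where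
  "sqdiff a b = \<bar>a\<^sup>2 - b\<^sup>2\<bar>"

inductive reduction_step :: "int multiset \<Rightarrow> int multiset \<Rightarrow> bool" where
  "reduction_step (add_mset a (add_mset b M)) (add_mset (sqdiff a b) M)"

text \<open>Each step lowers the size by one and needs two entries, so reaching a singleton
  is the same as continuing until a single entry remains. Zero steps are allowed, which
  matters only for a multiset that is already a singleton.\<close>

definition reduces_to_zero :: "int multiset \<Rightarrow> bool" where
  "reduces_to_zero M \<longleftrightarrow> reduction_step\<^sup>*\<^sup>* M {#0#}"

definition int_block :: "int \<Rightarrow> int \<Rightarrow> int set" where
  "int_block L n = {n..n + L - 1}"

end

theory Submission
  imports Defs "HOL-Computational_Algebra.Polynomial"
begin

text \<open>A reduction of a multiset to one entry is a binary tree whose leaves carry the entries. Since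
  \<open>sqdiff a b\<close> depends only on the squares of \<open>a\<close> and \<open>b\<close>, absolute values inside the tree can be
  dropped: the tree with leaves \<open>n + i\<close> has the value \<open>\<plusminus>P(n)\<close>, where \<open>P\<close> is the integer
  polynomial obtained by giving the leaf \<open>i\<close> the polynomial \<open>x + i\<close> and every inner node the
  difference of the squares of its children (\<open>pol\<close>).

  For the lengths 24 and 36 there are trees on the labels \<open>0..23\<close> and \<open>0..35\<close> whose polynomial is
  zero, so one tree serves all \<open>n\<close>. As \<open>sqdiff 0 0 = 0\<close>, blocks that reduce to zero can be
  concatenated, and every \<open>12k\<close> with \<open>k \<ge> 2\<close> is a sum of copies of 24 and 36.

  Conversely, a reduction step preserves the parity of the sum of the entries and the parity of the
  number of entries that are not divisible by 3. Applied to the blocks that start at \<open>n\<close> and at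
  \<open>n + 1\<close> and to the block that starts at 0, these invariants give \<open>12 dvd L\<close>.

  The hard part is \<open>L = 12\<close>. There are finitely many trees on the labels \<open>0..11\<close>, and if every block
  reduced to zero, then for every \<open>n\<close> one of their polynomials would vanish at \<open>n\<close>. The product of all
  these polynomials would be zero, hence so would one of them (\<open>universal_zero_tree\<close>).
  A tree with zero polynomial has two subtrees with equal squares, and with their children this
  becomes a relation \<open>A\<^sup>2 + B\<^sup>2 = C\<^sup>2 + D\<^sup>2\<close> between four trees that share out the twelve labels.
  Three facts make such relations rare:
  \<^item> The linear coefficient of a tree polynomial is even unless the tree is a leaf. Hence the number of
    leaves among the four trees is even.
  \<^item> Squares have positive leading coefficients, so the highest degree must occur on both sides. With
    so few labels, most shapes are excluded by their degrees.
  \<^item> A linear tree polynomial with at least four leaves has a leading coefficient divisible by 8,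
    with at least six leaves by 32 (\<open>linear_tree_divisibility\<close>), whereas labels differ by at
    most 11.

  If two of the four trees are leaves, the third fact gives a contradiction at once. Otherwise the
  numbers of leaves are 2, 2, 2, 6 or 2, 2, 3, 5 or 2, 2, 4, 4 or 2, 3, 3, 4 or 3, 3, 3, 3. Here the
  trees are so small that their polynomials can be written down. Comparing coefficients from the top
  leaves few possibilities for the differences of labels inside the trees, and these are
  excluded by congruences or by short searches in which the labels have to be distinct.\<close>

section \<open>Reductions as binary trees\<close>

datatype sqtree = Leaf int | Node sqtree sqtree

primrec labs :: "sqtree \<Rightarrow> int list" where
  "labs (Leaf i) = [i]"
| "labs (Node l r) = labs l @ labs r"

primrec val :: "sqtree \<Rightarrow> int" where
  "val (Leaf i) = i"
| "val (Node l r) = sqdiff (val l) (val r)"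

primrec shift :: "int \<Rightarrow> sqtree \<Rightarrow> sqtree" where
  "shift n (Leaf i) = Leaf (n + i)"
| "shift n (Node l r) = Node (shift n l) (shift n r)"

primrec pol :: "sqtree \<Rightarrow> int poly" where
  "pol (Leaf i) = [:i, 1:]"
| "pol (Node l r) = (pol l)\<^sup>2 - (pol r)\<^sup>2"

lemma labs_shift: "labs (shift n t) = map ((+) n) (labs t)"
  by (induction t) auto

lemma labs_nonempty [simp]: "labs t \<noteq> []"
  by (induction t) auto

lemma length_labs_ge_1: "length (labs t) \<ge> 1"
  by (simp add: Suc_le_eq)

lemma length_labs_eq_1: "length (labs t) = 1 \<longleftrightarrow> (\<exists>i. t = Leaf i)"
proof (cases t)
  case (Node l r)
  then show ?thesis using length_labs_ge_1[of l] length_labs_ge_1[of r] by simp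
qed simp

lemma shift_shift: "shift m (shift n t) = shift (m + n) t"
  by (induction t) auto

lemma shift_0: "shift 0 t = t"
  by (induction t) auto

text \<open>Squaring makes the statement inductive: the absolute values disappear at every node.\<close>

lemma val_shift_sq: "(val (shift n t))\<^sup>2 = (poly (pol t) n)\<^sup>2"
  by (induction t) (auto simp: sqdiff_def add.commute)

lemma val_shift_0_iff: "val (shift n t) = 0 \<longleftrightarrow> poly (pol t) n = 0"
  by (metis val_shift_sq power_eq_0_iff zero_power2)

text \<open>This undoes a reduction step: grafting a tree with two leaves onto the leaf that carries
  the new entry restores the old multiset. Adding the grafted entry on the left avoids
  differences of multisets.\<close>

lemma replace_leaf:
  assumes "val s \<in> set (labs t)"
  shows "\<exists>t'. add_mset (val s) (mset (labs t')) = mset (labs t) + mset (labs s) \<and> val t' = val t"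
  using assms
proof (induction t)
  case (Leaf i)
  then show ?case by (intro exI[of _ s]) auto
next
  case (Node l r)
  show ?case
  proof (cases "val s \<in> set (labs l)")
    case True
    with Node obtain l' where "add_mset (val s) (mset (labs l')) = mset (labs l) + mset (labs s)"
      "val l' = val l" by blast
    then show ?thesis
      by (intro exI[of _ "Node l' r"]) (simp add: ac_simps flip: union_mset_add_mset_left)
  next
    case False
    with Node obtain r' where "add_mset (val s) (mset (labs r')) = mset (labs r) + mset (labs s)"
      "val r' = val r" by auto
    then show ?thesis
      by (intro exI[of _ "Node l r'"]) (simp add: ac_simps flip: union_mset_add_mset_right)
  qed
qed

lemma tree_of_reduction:
  assumes "reduction_step\<^sup>*\<^sup>* M {#z#}"
  shows "\<exists>t. mset (labs t) = M \<and> val t = z"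
  using assms
proof (induction rule: converse_rtranclp_induct)
  case base
  show ?case by (intro exI[of _ "Leaf z"]) auto
next
  case (step M M')
  then obtain t where t: "mset (labs t) = M'" "val t = z" by blast
  from step(1) obtain a b N where M: "M = add_mset a (add_mset b N)" "M' = add_mset (sqdiff a b) N"
    by cases auto
  have "val (Node (Leaf a) (Leaf b)) \<in> set (labs t)"
    using t M by (metis set_mset_mset union_single_eq_member val.simps)
  from replace_leaf[OF this] t M show ?case by (auto simp: add_mset_commute)
qed

lemma reduction_of_tree:
  "reduction_step\<^sup>*\<^sup>* (mset (labs t) + N) (add_mset (val t) N)"
proof (induction t arbitrary: N)
  case (Leaf i)
  then show ?case by simp
next
  case (Node l r)
  have "reduction_step\<^sup>*\<^sup>* (mset (labs l) + (mset (labs r) + N)) (add_mset (val l) (mset (labs r)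
    + N))"
    by (rule Node)
  also have "add_mset (val l) (mset (labs r) + N) = mset (labs r) + add_mset (val l) N" by simp
  also have "reduction_step\<^sup>*\<^sup>* \<dots> (add_mset (val r) (add_mset (val l) N))" by (rule Node)
  also have "reduction_step (add_mset (val r) (add_mset (val l) N)) (add_mset (sqdiff (val r) (val
    l)) N)"
    by (rule reduction_step.intros)
  also have "sqdiff (val r) (val l) = val (Node l r)" by (simp add: sqdiff_def abs_minus_commute)
  finally show ?case by (simp add: union_assoc)
qed

lemma reduces_iff_tree: "reduces_to_zero M \<longleftrightarrow> (\<exists>t. mset (labs t) = M \<and> val t = 0)"
  using tree_of_reduction[of M 0] reduction_of_tree[of _ "{#}"]
  unfolding reduces_to_zero_def by (metis add.right_neutral)

text \<open>The two zeros that remain are merged by one more step.\<close>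

lemma reduces_union:
  assumes "reduces_to_zero M" "reduces_to_zero N"
  shows "reduces_to_zero (M + N)"
proof -
  obtain s t where "mset (labs s) = M" "val s = 0" "mset (labs t) = N" "val t = 0"
    using assms unfolding reduces_iff_tree by blast
  then show ?thesis
    unfolding reduces_iff_tree by (intro exI[of _ "Node s t"]) (simp add: sqdiff_def)
qed

section \<open>Zero trees on 24 and 36 consecutive integers\<close>

text \<open>Three groups of eight leaves are balanced separately. In the first and the third, the
  two quadruples are mirror images of each other and the polynomial of each is even about
  the centre of the group: around the centre \<open>19/2\<close>, for instance, the pairs \<open>0, 1\<close> and \<open>7, 10\<close>
  have gaps 1 and 3, and their midpoints are 9 and 1 away from it, so the linear terms of the
  squares of the two pairs agree.
  In the second group all pairs are concentric, and \<open>19\<^sup>2 - 11\<^sup>2 = 17\<^sup>2 - 7\<^sup>2\<close>.\<close>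

definition tree24 :: sqtree where
  "tree24 =
    (let q = (\<lambda>a b c d. Node (Node (Leaf a) (Leaf b)) (Node (Leaf c) (Leaf d))) in
     Node (Node (q 0 1 7 10) (q 9 12 18 19))
    (Node (Node (q 2 21 6 17) (q 3 20 8 15))
          (Node (q 4 5 11 14) (q 13 16 22 23))))"

text \<open>Besides groups of eight there are two groups of six, \<open>c \<plusminus> 2, c \<plusminus> 3, c \<plusminus> 10\<close> for
  \<open>c = 12\<close> and \<open>c = 23\<close>. They are balanced since
  \<open>((x + 3)\<^sup>2 - (x + 2)\<^sup>2)\<^sup>2 - ((x - 2)\<^sup>2 - (x - 3)\<^sup>2)\<^sup>2 = 40x = (x + 10)\<^sup>2 - (x - 10)\<^sup>2\<close>.\<close>

definition tree36 :: sqtree where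
  "tree36 =
    (let p = (\<lambda>a b. Node (Leaf a) (Leaf b));
         q = (\<lambda>a b c d. Node (p a b) (p c d)) in
     Node (Node (Node (q 0 34 1 35) (q 7 24 11 28)) (Node (p 2 22) (q 9 10 14 15)))
    (Node (Node (q 3 32 4 31) (q 12 23 16 19))
    (Node (Node (q 5 27 6 17) (q 8 30 18 29)) (Node (p 13 33) (q 20 21 25 26)))))"

lemma pol_tree24: "pol tree24 = 0"
  by (simp add: tree24_def Let_def power2_eq_square)

lemma pol_tree36: "pol tree36 = 0"
  by (simp add: tree36_def Let_def power2_eq_square)

lemma mset_labs_eq_block:
  assumes "sort xs = [0..k]"
  shows "mset xs = mset_set {0..k}"
  by (metis assms mset_sort set_upto distinct_upto mset_set_set)

lemma labs_tree24: "mset (labs tree24) = mset_set {0..23}"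
  by (rule mset_labs_eq_block) code_simp

lemma labs_tree36: "mset (labs tree36) = mset_set {0..35}"
  by (rule mset_labs_eq_block) code_simp

lemma mset_set_block_shift:
  "mset_set (int_block (k + 1) n) = image_mset ((+) n) (mset_set {0..k})"
proof -
  have "int_block (k + 1) n = (+) n ` {0..k}" by (auto simp: int_block_def)
  then show ?thesis by (simp add: image_mset_mset_set)
qed

lemma zero_tree_reduces_blocks:
  assumes "pol t = 0" "mset (labs t) = mset_set {0..k}"
  shows "reduces_to_zero (mset_set (int_block (k + 1) n))"
proof -
  have "val (shift n t) = 0" using assms by (simp add: val_shift_0_iff)
  moreover have "mset (labs (shift n t)) = mset_set (int_block (k + 1) n)"
    using assms(2) by (simp add: labs_shift mset_set_block_shift)
  ultimately show ?thesis unfolding reduces_iff_tree by blast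
qed

lemma int_block_append:
  assumes "K \<ge> 0" "L \<ge> 0"
  shows "mset_set (int_block (K + L) n) = mset_set (int_block K n) + mset_set (int_block L (n + K))"
proof -
  have "int_block (K + L) n = int_block K n \<union> int_block L (n + K)"
    using assms by (auto simp: int_block_def)
  moreover have "int_block K n \<inter> int_block L (n + K) = {}" by (auto simp: int_block_def)
  ultimately show ?thesis by (simp add: mset_set_Union int_block_def)
qed

text \<open>The induction removes an initial block of length 24; the lengths 24 and 36 are the two
  starting points.\<close>

lemma reduces_blocks_12:
  assumes "k \<ge> (2::nat)"
  shows "reduces_to_zero (mset_set (int_block (12 * int k) n))"
  using assms
proof (induction k arbitrary: n rule: less_induct)
  case (less k)
  have b24: "reduces_to_zero (mset_set (int_block 24 m))" for m
    using zero_tree_reduces_blocks[OF pol_tree24 labs_tree24, of m] by simp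
  have b36: "reduces_to_zero (mset_set (int_block 36 m))" for m
    using zero_tree_reduces_blocks[OF pol_tree36 labs_tree36, of m] by simp
  consider "k = 2" | "k = 3" | "k \<ge> 4" using less.prems by linarith
  then show ?case
  proof cases
    case 3
    have "12 * int k = 24 + 12 * int (k - 2)" using 3 by simp
    moreover have "mset_set (int_block (24 + 12 * int (k - 2)) n)
        = mset_set (int_block 24 n) + mset_set (int_block (12 * int (k - 2)) (n + 24))"
      by (rule int_block_append) simp_all
    moreover have "reduces_to_zero (mset_set (int_block (12 * int (k - 2)) (n + 24)))"
      using 3 by (intro less.IH) auto
    ultimately show ?thesis using reduces_union[OF b24] by metis
  qed (simp_all add: b24 b36)
qed

section \<open>Parity invariants\<close>

text \<open>A step replaces the contribution \<open>f a + f b\<close> to the sum by \<open>f (sqdiff a b)\<close>. The invariant is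
  used for the identity and for the indicator of the integers not divisible by 3.\<close>

lemma reduction_invariant:
  fixes f :: "int \<Rightarrow> int"
  assumes "reduction_step\<^sup>*\<^sup>* M N" and f: "\<And>a b. even (f (sqdiff a b)) = even (f a + f b)"
  shows "even (\<Sum>x\<in>#M. f x) = even (\<Sum>x\<in>#N. f x)"
  using assms(1)
proof (induction rule: rtranclp_induct)
  case (step N N')
  from step(2) have "even (\<Sum>x\<in>#N. f x) = even (\<Sum>x\<in>#N'. f x)"
    by cases (use f in \<open>auto simp: even_add\<close>)
  then show ?case using step by simp
qed simp

lemma even_sum_block:
  fixes f :: "int \<Rightarrow> int"
  assumes "reduces_to_zero (mset_set (int_block L n))"
   and "\<And>a b. even (f (sqdiff a b)) = even (f a + f b)" "f 0 = 0"
  shows "even (\<Sum>x\<in>int_block L n. f x)"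
  using reduction_invariant[OF assms(1)[unfolded reduces_to_zero_def] assms(2)] assms(3)
  by (simp add: sum_unfold_sum_mset)

lemma finite_int_block [simp]: "finite (int_block L n)"
  by (simp add: int_block_def)

lemma sum_int_block_first:
  assumes "L > 0"
  shows "(\<Sum>x\<in>int_block L n. f x) = f n + (\<Sum>x\<in>int_block (L - 1) (n + 1). f x)"
proof -
  have "int_block L n = insert n (int_block (L - 1) (n + 1))" "n \<notin> int_block (L - 1) (n + 1)"
    using assms by (auto simp: int_block_def)
  then show ?thesis by simp
qed

lemma sum_int_block_last:
  assumes "L > 0"
  shows "(\<Sum>x\<in>int_block L n. f x) = f (n + L - 1) + (\<Sum>x\<in>int_block (L - 1) n. f x)"
proof -
  have "int_block L n = insert (n + L - 1) (int_block (L - 1) n)" "n + L - 1 \<notin> int_block (L - 1) n"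
    using assms by (auto simp: int_block_def)
  then show ?thesis by simp
qed

text \<open>The block that starts at \<open>n + 1\<close> arises from the one that starts at \<open>n\<close> by exchanging \<open>n\<close> for
  \<open>n + L\<close>, and both have an even total.\<close>

lemma parity_periodic:
  fixes f :: "int \<Rightarrow> int"
  assumes red: "\<And>n. reduces_to_zero (mset_set (int_block L n))" and "L > 0"
   and f: "\<And>a b. even (f (sqdiff a b)) = even (f a + f b)" "f 0 = 0"
  shows "even (f n) = even (f (n + L))"
proof -
  have "even (\<Sum>x\<in>int_block L n. f x)" "even (\<Sum>x\<in>int_block L (n + 1). f x)"
    by (rule even_sum_block[OF red f])+
  then show ?thesis
    using sum_int_block_first[of L f n] sum_int_block_last[of L f "n + 1"] \<open>L > 0\<close> by simp
qed

lemma even_sqdiff: "even (sqdiff a b) = even (a + b)"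
  by (simp add: sqdiff_def)

text \<open>Squares are 0 or 1 modulo 3, so \<open>sqdiff\<close> acts on non-divisibility by 3 as exclusive or.\<close>

lemma three_dvd_sqdiff: "3 dvd sqdiff a b \<longleftrightarrow> (3 dvd a \<longleftrightarrow> 3 dvd b)"
proof -
  have sq: "x\<^sup>2 mod 3 = (if 3 dvd x then 0 else 1)" for x :: int
  proof -
    have "x mod 3 = 0 \<or> x mod 3 = 1 \<or> x mod 3 = 2" by presburger
    then consider "x mod 3 = 0" | "x mod 3 = 1" | "x mod 3 = 2" by blast
    then show ?thesis
      by cases (use power_mod[of x 3 2] in \<open>simp_all add: dvd_eq_mod_eq_0\<close>)
  qed
  have "3 dvd sqdiff a b \<longleftrightarrow> a\<^sup>2 mod 3 = b\<^sup>2 mod 3"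
    by (simp add: sqdiff_def mod_eq_dvd_iff)
  then show ?thesis by (auto simp: sq)
qed

lemma gauss_block: "L \<ge> 0 \<Longrightarrow> 2 * (\<Sum>x\<in>int_block L 0. x) = L * (L - 1)"
proof (induction L rule: int_ge_induct)
  case base then show ?case by (simp add: int_block_def)
next
  case (step L)
  have "(\<Sum>x\<in>int_block (L + 1) 0. x) = L + (\<Sum>x\<in>int_block L 0. x)"
    using sum_int_block_last[of "L + 1" _ 0] step by simp
  then show ?case using step by (simp add: algebra_simps)
qed

text \<open>Periodicity with period \<open>L\<close> of the parity of \<open>n\<close> and of divisibility by 3 gives the factors 2
  and 3. The sum \<open>L (L - 1) / 2\<close> of the block at 0 has to be even as well, which yields the
  second factor 2.\<close>

lemma twelve_dvd_length:
  assumes red: "\<And>n. reduces_to_zero (mset_set (int_block L n))" and "L > 0"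
  shows "12 dvd L"
proof -
  have "even L"
    using parity_periodic[OF assms, of "\<lambda>x. x" 0] even_sqdiff by simp
  have "even (\<Sum>x\<in>int_block L 0. x)"
    using even_sum_block[OF red, of "\<lambda>x. x"] even_sqdiff by simp
  then obtain m where "(\<Sum>x\<in>int_block L 0. x) = 2 * m" by blast
  then have "4 * m = L * (L - 1)" using gauss_block[of L] \<open>L > 0\<close> by simp
  moreover obtain h where "L = 2 * h" using \<open>even L\<close> by blast
  ultimately have "2 * m = h * (2 * h - 1)" by simp
  then have "even (h * (2 * h - 1))" by (metis dvd_triv_left)
  then have "4 dvd L" using \<open>L = 2 * h\<close> by auto
  moreover have "3 dvd L"
  proof -
    have "even (of_bool (\<not> 3 dvd (0::int)) :: int) = even (of_bool (\<not> 3 dvd (0 + L)) :: int)"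
      by (rule parity_periodic[OF assms]) (auto simp: three_dvd_sqdiff)
    then show ?thesis by (cases "3 dvd L") auto
  qed
  ultimately show ?thesis by presburger
qed

section \<open>One tree for all translates\<close>

lemma finite_trees: "finite {t. set (labs t) \<subseteq> A \<and> length (labs t) \<le> k}" if "finite A"
proof (induction k)
  case 0
  show ?case by simp
next
  case (Suc k)
  let ?T = "{t. set (labs t) \<subseteq> A \<and> length (labs t) \<le> k}"
  have "{t. set (labs t) \<subseteq> A \<and> length (labs t) \<le> Suc k}
    \<subseteq> Leaf ` A \<union> case_prod Node ` (?T \<times> ?T)"
  proof
    fix t assume t: "t \<in> {t. set (labs t) \<subseteq> A \<and> length (labs t) \<le> Suc k}"
    show "t \<in> Leaf ` A \<union> case_prod Node ` (?T \<times> ?T)"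
    proof (cases t)
      case (Leaf i)
      then show ?thesis using t by simp
    next
      case (Node l r)
      have "length (labs l) + length (labs r) \<le> Suc k" using t Node by simp
      then have "l \<in> ?T" "r \<in> ?T" using t Node length_labs_ge_1[of l] length_labs_ge_1[of r] by auto
      then have "case_prod Node (l, r) \<in> case_prod Node ` (?T \<times> ?T)"
        by (intro imageI) simp
      then show ?thesis using Node by simp
    qed
  qed
  moreover have "finite (Leaf ` A \<union> case_prod Node ` (?T \<times> ?T))"
    using Suc \<open>finite A\<close> by simp
  ultimately show ?case by (rule finite_subset)
qed

text \<open>For every \<open>n\<close> one of finitely many polynomials vanishes at \<open>n\<close>, so their product vanishes
  everywhere; integer polynomials have no zero divisors.\<close>

lemma universal_zero_tree:
  assumes red: "\<And>n. reduces_to_zero (mset_set (int_block (k + 1) n))"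
  obtains t where "mset (labs t) = mset_set {0..k}" "pol t = 0"
proof -
  define T where "T = {t. mset (labs t) = mset_set {0..k}}"
  have "set (labs t) = {0..k} \<and> length (labs t) = card {0..k}" if "t \<in> T" for t
  proof -
    have "mset (labs t) = mset_set {0..k}" using that by (simp add: T_def)
    then have "set_mset (mset (labs t)) = set_mset (mset_set {0..k})"
      "size (mset (labs t)) = size (mset_set {0..k})" by metis+
    then show ?thesis by simp
  qed
  then have "T \<subseteq> {t. set (labs t) \<subseteq> {0..k} \<and> length (labs t) \<le> card {0..k}}"
    by (simp add: subset_iff)
  then have fin: "finite T" by (rule finite_subset) (intro finite_trees finite_atLeastAtMost_int)
  have "\<exists>t\<in>T. poly (pol t) n = 0" for n
  proof -
    obtain s where s: "mset (labs s) = mset_set (int_block (k + 1) n)" "val s = 0"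
      using red[of n] reduces_iff_tree by blast
    have "shift (- n) s \<in> T"
      using s(1) by (simp add: T_def labs_shift mset_set_block_shift multiset.map_comp o_def)
    moreover have "poly (pol (shift (- n) s)) n = 0"
      using s(2) val_shift_0_iff[of n "shift (- n) s"] by (simp add: shift_shift shift_0)
    ultimately show ?thesis by blast
  qed
  then have "poly (\<Prod>t\<in>T. pol t) n = 0" for n
    using fin by (simp add: poly_prod prod_zero_iff)
  then have "(\<Prod>t\<in>T. pol t) = 0" using poly_all_0_iff_0 by blast
  then obtain t where "t \<in> T" "pol t = 0" using fin by (auto simp: prod_zero_iff)
  then show thesis using that by (simp add: T_def)
qed

section \<open>Degrees and parities of tree polynomials\<close>

lemma square_linear: "[:b, a:]\<^sup>2 = [:b * b, 2 * (a * b), a * a:]" for a b :: int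
  by (simp add: power2_eq_square)

lemma square_quadratic:
  "[:k, m, l:]\<^sup>2 = [:k * k, 2 * (k * m), 2 * (k * l) + m * m, 2 * (l * m), l * l:]" for k l m :: int
  by (simp add: power2_eq_square)

lemma coeff_square_top:
  fixes p :: "int poly"
  assumes "degree p \<le> m"
  shows "coeff (p\<^sup>2) (2 * m) = (coeff p m)\<^sup>2"
proof (cases "degree p = m")
  case True
  then show ?thesis
    using coeff_mult_degree_sum[of p p] by (simp add: power2_eq_square mult_2)
next
  case False
  then have "coeff p m = 0" "degree (p\<^sup>2) < 2 * m"
    using assms degree_power_le[of p 2] by (auto simp: coeff_eq_0)
  then show ?thesis by (simp add: coeff_eq_0)
qed

text \<open>The leading terms of two real squares are nonnegative and cannot cancel.\<close>

lemma degree_sum_squares: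
  fixes p q :: "int poly"
  assumes "degree (p\<^sup>2 + q\<^sup>2) \<le> 2 * k"
  shows "degree p \<le> k" "degree q \<le> k"
proof -
  define m where "m = max (degree p) (degree q)"
  have "m \<le> k"
  proof (rule ccontr)
    assume "\<not> m \<le> k"
    then have "coeff (p\<^sup>2 + q\<^sup>2) (2 * m) = 0"
      using assms by (intro coeff_eq_0) linarith
    moreover have "coeff (p\<^sup>2 + q\<^sup>2) (2 * m) = (coeff p m)\<^sup>2 + (coeff q m)\<^sup>2"
      by (simp add: coeff_square_top m_def)
    ultimately have "coeff p m = 0" "coeff q m = 0"
      by (simp_all add: sum_power2_eq_zero_iff)
    then show False using \<open>\<not> m \<le> k\<close> unfolding m_def
      by (metis leading_coeff_0_iff degree_0 le0 max_def)
  qed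
  then show "degree p \<le> k" "degree q \<le> k" by (auto simp: m_def)
qed

text \<open>The factors of \<open>p\<^sup>2 - q\<^sup>2 = (p + q) (p - q)\<close> have degree at most \<open>k\<close>, and their sum and
  difference are \<open>2p\<close> and \<open>2q\<close>.\<close>

lemma degree_diff_squares:
  fixes p q :: "int poly"
  assumes "p\<^sup>2 \<noteq> q\<^sup>2" "degree (p\<^sup>2 - q\<^sup>2) \<le> k"
  shows "degree p \<le> k" "degree q \<le> k"
proof -
  have eq: "p\<^sup>2 - q\<^sup>2 = (p + q) * (p - q)" by (simp add: power2_eq_square algebra_simps)
  then have "p + q \<noteq> 0" "p - q \<noteq> 0" using assms(1) by auto
  then have "degree (p + q) \<le> k" "degree (p - q) \<le> k"
    using assms(2) by (simp_all add: eq degree_mult_eq)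
  then have "degree ((p + q) + (p - q)) \<le> k" "degree ((p + q) - (p - q)) \<le> k"
    by (blast intro: degree_add_le degree_diff_le)+
  moreover have "(p + q) + (p - q) = smult 2 p" "(p + q) - (p - q) = smult 2 q"
    by (simp_all add: poly_eq_iff numeral_poly)
  ultimately show "degree p \<le> k" "degree q \<le> k" by simp_all
qed

lemma coeff_square_1: "coeff (p\<^sup>2) 1 = 2 * coeff p 0 * coeff (p :: int poly) 1"
  by (simp add: power2_eq_square coeff_mult)

lemma coeff_square_2: "coeff (p\<^sup>2) 2 = 2 * coeff p 0 * coeff p 2 + (coeff (p :: int poly) 1)\<^sup>2"
  by (simp add: power2_eq_square coeff_mult numeral_2_eq_2)

text \<open>The linear coefficient of a square is twice a product.\<close>

lemma even_linear_coeff: "even (coeff (pol t) 1) \<longleftrightarrow> length (labs t) \<noteq> 1"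
proof (cases t)
  case (Node l r)
  have "length (labs t) \<ge> 2"
    using Node length_labs_ge_1[of l] length_labs_ge_1[of r] by simp
  moreover have "even (coeff (pol t) 1)" using Node by (simp add: coeff_square_1 del: One_nat_def)
  ultimately show ?thesis by simp
qed simp

lemma linear_poly_eq:
  assumes "degree p \<le> 1"
  shows "p = [:coeff p 0, coeff p 1:]"
  using assms
  by (intro poly_eqI) (simp add: coeff_pCons coeff_eq_0 split: nat.split)

text \<open>By \<open>degree_diff_squares\<close>, the children of a node with nonzero constant polynomial would be
  constant, hence zero by induction.\<close>

lemma constant_pol_eq_0: "degree (pol t) = 0 \<Longrightarrow> pol t = 0"
proof (induction t)
  case (Node l r)
  show ?case
  proof (rule ccontr)
    assume "pol (Node l r) \<noteq> 0"
    then have "(pol l)\<^sup>2 \<noteq> (pol r)\<^sup>2" by simp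
    with degree_diff_squares[OF this, of 0] Node have "pol l = 0" "pol r = 0" by auto
    then show False using \<open>(pol l)\<^sup>2 \<noteq> (pol r)\<^sup>2\<close> by simp
  qed
qed simp

text \<open>A linear polynomial arises only from two linear children with the same leading
  coefficient up to sign, as \<open>(ax + p)\<^sup>2 - (ax + q)\<^sup>2 = 2a (p - q) x + (p\<^sup>2 - q\<^sup>2)\<close>. Two leaves give an even
  leading coefficient. The congruence \<open>b \<equiv> a/2\<close> modulo 2 for the constant term is carried along
  because it makes \<open>p - q\<close> even, so that every further node multiplies the leading coefficient by a
  multiple of 4. A leaf cannot be combined with a larger tree, whose leading coefficient is even.\<close>

lemma linear_tree_divisibility:
  assumes "pol t = [:b, a:]" "a \<noteq> 0" "length (labs t) \<noteq> 1"
  shows "even (length (labs t)) \<and> even a \<and> even (b - a div 2)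
    \<and> (length (labs t) \<ge> 4 \<longrightarrow> 8 dvd a) \<and> (length (labs t) \<ge> 6 \<longrightarrow> 32 dvd a)"
  using assms
proof (induction t arbitrary: a b)
  case (Node l r)
  define la lb ra rb where defs: "la = coeff (pol l) 1" "lb = coeff (pol l) 0" "ra
    = coeff (pol r) 1" "rb = coeff (pol r) 0"
  have eq: "(pol l)\<^sup>2 - (pol r)\<^sup>2 = [:b, a:]" using Node.prems by simp
  then have "(pol l)\<^sup>2 \<noteq> (pol r)\<^sup>2" using \<open>a \<noteq> 0\<close> by auto
  from degree_diff_squares[OF this, of 1]
  have "degree (pol l) \<le> 1" "degree (pol r) \<le> 1" by (simp_all add: eq)
  then have l: "pol l = [:lb, la:]" and r: "pol r = [:rb, ra:]"
    unfolding defs by (blast intro: linear_poly_eq)+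
  have c: "la\<^sup>2 = ra\<^sup>2" "a = 2 * (lb * la - rb * ra)" "b = lb\<^sup>2 - rb\<^sup>2"
    using eq by (auto simp: l r power2_eq_square algebra_simps)
  have "la \<noteq> 0" "ra \<noteq> 0" using c \<open>a \<noteq> 0\<close> by auto
  have sgn: "ra = la \<or> ra = - la" using c(1) by (auto simp: power2_eq_iff)
  \<comment> \<open>The constant coefficient of the right child, once its sign is chosen so that the leading
    coefficients of both children agree.\<close>
  define e where "e = (if ra = la then rb else - rb)"
  have e: "a = 2 * (lb - e) * la" "b = (lb - e) * (lb + e)" "even (e - rb)" 
    using c sgn by (auto simp: e_def power2_eq_square algebra_simps)
  have par: "length (labs l) = 1 \<longleftrightarrow> length (labs r) = 1"
    using even_linear_coeff[of l] even_linear_coeff[of r] c(1)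
    by (metis defs(1,3) even_power pos2)
  show ?case
  proof (cases "length (labs l) = 1")
    case True
    then obtain i j where "l = Leaf i" "r = Leaf j"
      using par unfolding length_labs_eq_1 by blast
    then have "la = 1" "ra = 1" "lb = i" "rb = j" using l r by auto
    then show ?thesis using e True par by (simp add: e_def)
  next
    case False
    then have L: "even (length (labs l))" "even la" "even (lb - la div 2)"
      "length (labs l) \<ge> 4 \<longrightarrow> 8 dvd la"
      using Node.IH(1)[OF l \<open>la \<noteq> 0\<close>] by auto
    have R: "even (length (labs r))" "even ra" "even (rb - ra div 2)"
      "length (labs r) \<ge> 4 \<longrightarrow> 8 dvd ra"
      using Node.IH(2)[OF r \<open>ra \<noteq> 0\<close>] False par by auto
    obtain g where g: "la = 2 * g" using L(2) by blast
    have "la div 2 = g" "ra div 2 = g \<or> ra div 2 = - g" using sgn g by auto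
    with L(3) R(3) e(3) have "even (lb - e)" by presburger
    then obtain f where f: "lb - e = 2 * f" by blast
    have a: "a = 4 * f * la" using e(1) f by simp
    have "even (lb + e)" using \<open>even (lb - e)\<close> by simp
    then obtain h where "lb + e = 2 * h" by blast
    then have b: "b = 4 * f * h" using e(2) f by simp
    have "32 dvd a" if "length (labs (Node l r)) \<ge> 6"
    proof -
      have "length (labs l) \<ge> 4 \<or> length (labs r) \<ge> 4"
        using that L(1) R(1) by (simp, presburger)
      then have "8 dvd la" using L(4) R(4) sgn by auto
      then obtain u where "la = 8 * u" by blast
      then have "a = 32 * (f * u)" using a by simp
      then show ?thesis by (metis dvd_triv_left)
    qed
    moreover have "a = 8 * (f * g)" using a g by simp
    then have "8 dvd a" "even a" "a div 2 = 2 * (2 * f * g)" by simp_all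
    moreover have "b = 2 * (2 * f * h)" using b by simp
    ultimately show ?thesis using L(1) R(1) by simp
  qed
qed simp

lemma leaf_iff_of_squares_eq:
  assumes "(pol s)\<^sup>2 = (pol t)\<^sup>2"
  shows "length (labs s) = 1 \<longleftrightarrow> length (labs t) = 1"
proof -
  have "pol s = pol t \<or> pol s = - pol t" using assms by (simp add: power2_eq_iff)
  then have "even (coeff (pol s) 1) \<longleftrightarrow> even (coeff (pol t) 1)" by auto
  then show ?thesis by (simp add: even_linear_coeff del: One_nat_def)
qed

lemma degree_le_1_square:
  fixes p :: "int poly"
  assumes "p\<^sup>2 = [:u, v, w:]"
  shows "degree p \<le> 1"
proof (cases "p = 0")
  case False
  then have "2 * degree p = degree (p\<^sup>2)" by (simp add: degree_power_eq)
  also have "\<dots> \<le> 2" unfolding assms by simp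
  finally show ?thesis by simp
qed simp

lemma degree_le_1_of_square_quadratic:
  fixes p :: "int poly"
  assumes "p\<^sup>2 = [:u, v, w:]\<^sup>2" "w = 0"
  shows "degree p \<le> 1"
  by (rule degree_le_1_square[of p "u * u" "2 * (v * u)"
    "v * v"]) (use assms in \<open>simp add: square_linear\<close>)

section \<open>Trees labelled from 0 to 11\<close>

definition admissible :: "sqtree \<Rightarrow> bool" where "admissible t \<longleftrightarrow> distinct (labs t)
  \<and> set (labs t) \<subseteq> {0..11}"

definition disjoint_labels :: "sqtree list \<Rightarrow> bool" where
  "disjoint_labels ts \<longleftrightarrow> distinct (concat (map labs ts)) \<and> set (concat (map labs ts)) \<subseteq> {0..11}"

lemma disjoint_labels_admissible: "disjoint_labels ts \<Longrightarrow> t \<in> set ts \<Longrightarrow> admissible t"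
  by (induction ts) (auto simp: disjoint_labels_def admissible_def)

lemma disjoint_labels_distinct:
  assumes "disjoint_labels [A, B, C, D]"
    and "distinct as" "set (labs A) = set as" "distinct bs" "set (labs B) = set bs"
    and "distinct cs" "set (labs C) = set cs" "distinct ds" "set (labs D) = set ds"
  shows "distinct (as @ bs @ cs @ ds)"
  using assms by (simp add: disjoint_labels_def)

section \<open>Relations in which two of the four trees are leaves\<close>

lemma leaf_shape:
  assumes "admissible t" "length (labs t) = 1"
  obtains c where "t = Leaf c" "c \<in> {0..11}"
  using assms length_labs_eq_1[of t] by (auto simp: admissible_def)

text \<open>The trees \<open>C\<close> and \<open>D\<close> would be linear with even leading coefficients whose squares add up
  to 2.\<close>

lemma no_leaves_same_side:
  assumes eq: "(pol A)\<^sup>2 + (pol B)\<^sup>2 = (pol C)\<^sup>2 + (pol D)\<^sup>2"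
    and len: "length (labs A) = 1" "length (labs B) = 1" "length (labs C) \<noteq> 1" "length (labs D) \<noteq> 1"
  shows False
proof -
  obtain i j where l: "A = Leaf i" "B = Leaf j" using len length_labs_eq_1 by blast
  have sum: "(pol C)\<^sup>2 + (pol D)\<^sup>2 = [:i * i + j * j, 2 * i + 2 * j, 2:]"
    unfolding eq[symmetric] l by (simp add: square_linear)
  then have "degree ((pol C)\<^sup>2 + (pol D)\<^sup>2) \<le> 2 * 1" by simp
  then have "degree (pol C) \<le> 1" "degree (pol D) \<le> 1" by (rule degree_sum_squares)+
  then obtain u v w z where C: "pol C = [:u, v:]" and D: "pol D = [:w, z:]"
    using linear_poly_eq by metis
  have "even v" "even z" using even_linear_coeff[of C] even_linear_coeff[of D] len unfolding C D
    by auto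
  then obtain v' z' where "v = 2 * v'" "z = 2 * z'" by blast
  moreover have "v * v + z * z = 2" using sum unfolding C D by (simp add: square_linear)
  ultimately have "4 * (v' * v' + z' * z') = 2" by simp
  then show False by presburger
qed

text \<open>The leaves \<open>i\<close> and \<open>j\<close> contribute the polynomial \<open>2 (i - j) x + i\<^sup>2 - j\<^sup>2\<close> of degree 1. The other
  two trees are then linear with the same leading coefficient up to sign, one of them has at
  least six leaves, and so 32 divides \<open>i - j\<close>.\<close>

lemma no_leaves_opposite_sides:
  assumes fam: "disjoint_labels [A, B, C, D]" and eq: "(pol A)\<^sup>2 + (pol B)\<^sup>2
    = (pol C)\<^sup>2 + (pol D)\<^sup>2"
    and len: "length (labs A) = 1" "length (labs C) = 1" "length (labs B) \<noteq> 1" "length (labs D) \<noteq> 1"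
     "length (labs B) + length (labs D) = 10"
  shows False
proof -
  have admissible: "admissible A" "admissible C" using disjoint_labels_admissible[OF fam] by auto
  obtain i j where l: "A = Leaf i" "i \<in> {0..11}" "C = Leaf j" "j \<in> {0..11}"
    using leaf_shape[OF admissible(1) len(1)] leaf_shape[OF admissible(2) len(2)] by metis
  have "i \<noteq> j" using fam l by (auto simp: disjoint_labels_def)
  have "(pol D)\<^sup>2 - (pol B)\<^sup>2 = (pol A)\<^sup>2 - (pol C)\<^sup>2" using eq by (simp add: algebra_simps)
  also have "\<dots> = [:i * i - j * j, 2 * (i - j):]" unfolding l by (simp add: square_linear)
  finally have diff: "(pol D)\<^sup>2 - (pol B)\<^sup>2 = [:i * i - j * j, 2 * (i - j):]" .
  then have "(pol D)\<^sup>2 \<noteq> (pol B)\<^sup>2" using \<open>i \<noteq> j\<close> by auto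
  moreover have "degree ((pol D)\<^sup>2 - (pol B)\<^sup>2) \<le> 1" unfolding diff by simp
  ultimately have "degree (pol D) \<le> 1" "degree (pol B) \<le> 1" by (rule degree_diff_squares)+
  then obtain u v w z where D: "pol D = [:u, v:]" and B: "pol B = [:w, z:]"
    using linear_poly_eq by metis
  have co: "v * v = z * z" "v * u - z * w = i - j"
    using diff unfolding B D by (simp_all add: square_linear)
  have vz: "v = z \<or> v = - z" using co(1) by (simp add: square_eq_iff)
  have "z \<noteq> 0" "v \<noteq> 0" using co vz \<open>i \<noteq> j\<close> by auto
  have "even (length (labs B))" "length (labs B) \<ge> 6 \<longrightarrow> 32 dvd z"
    "even (length (labs D))" "length (labs D) \<ge> 6 \<longrightarrow> 32 dvd v"
    using linear_tree_divisibility[OF B \<open>z \<noteq> 0\<close>] linear_tree_divisibility[OF D \<open>v \<noteq> 0\<close>] len by auto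
  moreover have "length (labs B) \<ge> 6 \<or> length (labs D) \<ge> 6"
    using len(5) calculation(1,3) by presburger
  ultimately have "32 dvd z" "32 dvd v" using vz by auto
  then have "32 dvd i - j" unfolding co(2)[symmetric] by simp
  moreover have "\<bar>i - j\<bar> \<le> 11" using l by auto
  ultimately show False using \<open>i \<noteq> j\<close> by presburger
qed

section \<open>Polynomials of trees with two, three and four leaves\<close>

text \<open>This is \<open>(x + i + d)\<^sup>2 - (x + i)\<^sup>2\<close>, the polynomial of a pair of leaves with gap \<open>d\<close>.\<close>

definition pair_poly :: "int \<Rightarrow> int \<Rightarrow> int poly" where "pair_poly i d = [:d * (2 * i + d), 2 * d:]"

lemma admissible_Node: "admissible (Node l r) \<longleftrightarrow> admissible l \<and> admissible r
  \<and> set (labs l) \<inter> set (labs r) = {}"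
  by (auto simp: admissible_def)

lemma pair_shape:
  assumes "admissible t" "length (labs t) = 2"
  obtains i d where "0 \<le> i" "1 \<le> d" "i + d \<le> 11" "set (labs t) = set [i, i + d]"
    "(pol t)\<^sup>2 = (pair_poly i d)\<^sup>2"
proof -
  obtain l r where t: "t = Node l r" using assms by (cases t) auto
  then have "length (labs l) = 1" "length (labs r) = 1"
    using assms length_labs_ge_1[of l] length_labs_ge_1[of r] by auto
  then obtain a b where ab: "t = Node (Leaf a) (Leaf b)" using t length_labs_eq_1 by blast
  then have "a \<noteq> b" "a \<in> {0..11}" "b \<in> {0..11}" using assms by (auto simp: admissible_def)
  show thesis
  proof (cases "a < b")
    case True
    have "(pol t)\<^sup>2 = (pair_poly a (b - a))\<^sup>2"
      unfolding ab pol.simps pair_poly_def square_linear by (simp add: square_linear algebra_simps)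
    then show thesis using that[of a "b - a"] True ab \<open>a \<in> _\<close> \<open>b \<in> _\<close> by auto
  next
    case False
    have "(pol t)\<^sup>2 = (pair_poly b (a - b))\<^sup>2"
      unfolding ab pol.simps pair_poly_def square_linear by (simp add: square_linear algebra_simps)
    then show thesis using that[of b "a - b"] False ab \<open>a \<noteq> b\<close> \<open>a \<in> _\<close> \<open>b \<in> _\<close> by auto
  qed
qed

lemma tree_split:
  assumes "length (labs t) = n" "n \<ge> 2"
  obtains l r where "t = Node l r" "length (labs l) + length (labs r) = n"
    "length (labs l) \<ge> 1" "length (labs r) \<ge> 1"
  using assms by (cases t) (auto simp: length_labs_ge_1 Suc_le_eq)

text \<open>Only squares of tree polynomials enter the relations, so the children of a node may be
  ordered by size.\<close>

lemma tree_split_le: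
  assumes "admissible t" "length (labs t) = n" "n \<ge> 2"
  obtains l r where "admissible l" "admissible r" "set (labs l) \<inter> set (labs r) = {}"
    "set (labs t) = set (labs l) \<union> set (labs r)"
    "(pol t)\<^sup>2 = ((pol l)\<^sup>2 - (pol r)\<^sup>2)\<^sup>2"
    "pol t = (pol l)\<^sup>2 - (pol r)\<^sup>2 \<or> pol t = (pol r)\<^sup>2 - (pol l)\<^sup>2"
    "length (labs l) + length (labs r) = n" "1 \<le> length (labs l)"
      "length (labs l) \<le> length (labs r)"
proof -
  obtain l r where t: "t = Node l r" "length (labs l) + length (labs r) = n"
    "length (labs l) \<ge> 1" "length (labs r) \<ge> 1"
    using tree_split assms(2,3) by metis
  show thesis
  proof (cases "length (labs l) \<le> length (labs r)")
    case True
    then show thesis using that[of l r] t assms(1) by (simp add: admissible_Node)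
  next
    case False
    then show thesis using that[of r l] t assms(1)
      by (simp add: admissible_Node Int_commute Un_commute add.commute power2_commute)
  qed
qed

lemma pair_poly_square: "(pair_poly i p)\<^sup>2
  = [:p * p * ((2 * i + p) * (2 * i + p)), 4 * (p * p * (2 * i + p)), 4 * (p * p):]"
  by (simp add: pair_poly_def square_linear)

lemma pair_injective:
  fixes i j p q :: int
  assumes "(pair_poly i p)\<^sup>2 = (pair_poly j q)\<^sup>2" "1 \<le> p" "1 \<le> q" 
  shows "i = j"
proof -
  have "pair_poly i p = pair_poly j q \<or> pair_poly i p = - pair_poly j q" using assms(1)
    by (simp add: power2_eq_iff)
  then show ?thesis using assms(2,3) by (auto simp: pair_poly_def)
qed

text \<open>The linear coefficient of \<open>(pair_poly i a)\<^sup>2 - (x + c)\<^sup>2\<close>, the polynomial of a triple; the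
  constant coefficient is \<open>trip_cst a i c\<close> and the leading coefficient is \<open>4a\<^sup>2 - 1\<close>. Powers are
  spelled out as products because the simplifier evaluates these faster.\<close>

definition trip_lin :: "int \<Rightarrow> int \<Rightarrow> int \<Rightarrow> int" where "trip_lin a i c
  = 4 * (a * a) * (2 * i + a) - 2 * c"

definition trip_cst :: "int \<Rightarrow> int \<Rightarrow> int \<Rightarrow> int" where "trip_cst a i c
  = a * a * ((2 * i + a) * (2 * i + a)) - c * c"

lemma trip_lead_pos: "1 \<le> a \<Longrightarrow> 3 \<le> 4 * (a * a) - (1 :: int)"
  using mult_mono[of 1 a 1 a] by simp

lemma trip_lead_inj: "a = b" if "4 * (a * a) - 1 = 4 * (b * b) - (1 :: int)" "1 \<le> a" "1 \<le> b"
  using that by (simp flip: power2_eq_square)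

text \<open>The equation of the linear coefficients says \<open>4a\<^sup>2 (i - i') = c - c'\<close>, which is at most 11 in
  absolute value. Hence \<open>a = 1\<close> and the two pairs are at distance 1 or 2; at distance 1
  they would share a label.\<close>

lemma parallel_trips:
  fixes a i i' c c' :: int
  assumes a: "1 \<le> a" and r: "0 \<le> c" "c \<le> 11" "0 \<le> c'" "c' \<le> 11"
    and dst: "distinct [i, i + a, c, i', i' + a, c']"
    and e3: "trip_lin a i c = trip_lin a i' c'"
  shows "a = 1 \<and> \<bar>i - i'\<bar> = 2 \<and> c' = c - 4 * (i - i')"
proof -
  have eq: "4 * (a * a) * (i - i') = c - c'" using e3 by (simp add: trip_lin_def algebra_simps)
  have "i \<noteq> i'" using dst by auto
  then have "4 * (a * a) * 1 \<le> 4 * (a * a) * \<bar>i - i'\<bar>" by (intro mult_left_mono) auto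
  also have "\<dots> = \<bar>c - c'\<bar>" using arg_cong[OF eq, of abs] by (simp add: abs_mult)
  also have "\<dots> \<le> 11" using r by auto
  finally have "a * a \<le> 2" by simp
  moreover have "2 * 2 \<le> a * a" if "2 \<le> a" using that by (intro mult_mono) auto
  ultimately have "\<not> 2 \<le> a" by linarith
  then have "a = 1" using a by simp
  have c': "c' = c - 4 * (i - i')" using eq \<open>a = 1\<close> by simp
  have "i \<noteq> i' + 1" "i' \<noteq> i + 1" using dst \<open>a = 1\<close> by auto
  moreover have "\<bar>4 * (i - i')\<bar> \<le> 11" using r unfolding c' by auto
  ultimately have "\<bar>i - i'\<bar> = 2" using \<open>i \<noteq> i'\<close> by presburger
  then show ?thesis using \<open>a = 1\<close> c' by simp
qed

lemma trip_shape:
  assumes "admissible t" "length (labs t) = 3"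
  obtains i d c where "0 \<le> i" "1 \<le> d" "i + d \<le> 11" "0 \<le> c" "c \<le> 11" "distinct [i, i + d, c]"
    "set (labs t) = set [i, i + d, c]" "(pol t)\<^sup>2
      = [:trip_cst d i c, trip_lin d i c, 4 * (d * d) - 1:]\<^sup>2"
proof -
  obtain l r where lr: "admissible l" "admissible r" "set (labs l) \<inter> set (labs r) = {}"
    "set (labs t) = set (labs l) \<union> set (labs r)"
    "(pol t)\<^sup>2 = ((pol l)\<^sup>2 - (pol r)\<^sup>2)\<^sup>2" "length (labs l) = 1" "length (labs r) = 2"
    by (rule tree_split_le[OF assms]) auto
  from lr obtain c where c: "l = Leaf c" "c \<in> {0..11}" using leaf_shape by blast
  from lr obtain i d where r: "0 \<le> i" "1 \<le> d" "i + d \<le> 11" "set (labs r) = set [i, i + d]"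
    "(pol r)\<^sup>2 = (pair_poly i d)\<^sup>2" using pair_shape by metis
  have "(pol t)\<^sup>2 = ((pair_poly i d)\<^sup>2 - [:c, 1:]\<^sup>2)\<^sup>2"
    using lr(5) by (simp add: r(5) c(1) power2_commute[of "(pair_poly i d)\<^sup>2"])
  also have "(pair_poly i d)\<^sup>2 - [:c, 1:]\<^sup>2 = [:trip_cst d i c, trip_lin d i c, 4 * (d * d) - 1:]"
    by (simp add: pair_poly_def square_linear trip_cst_def trip_lin_def algebra_simps)
  finally show thesis using that[of i d c] lr(3,4) r c by auto
qed

text \<open>The bound on the degree excludes the split into one and three leaves, which has degree 4.\<close>

lemma quad_shape:
  assumes "admissible t" "length (labs t) = 4" "degree (pol t) \<le> 3"
  obtains i d j e where "0 \<le> i" "1 \<le> d" "i + d \<le> 11" "0 \<le> j" "1 \<le> e" "j + e \<le> 11"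
    "distinct [i, i + d, j, j + e]" "set (labs t) = set [i, i + d, j, j + e]"
    "(pol t)\<^sup>2 = ((pair_poly i d)\<^sup>2 - (pair_poly j e)\<^sup>2)\<^sup>2"
proof -
  obtain l r where lr: "admissible l" "admissible r" "set (labs l) \<inter> set (labs r) = {}"
    "set (labs t) = set (labs l) \<union> set (labs r)"
    "(pol t)\<^sup>2 = ((pol l)\<^sup>2 - (pol r)\<^sup>2)\<^sup>2"
    "pol t = (pol l)\<^sup>2 - (pol r)\<^sup>2 \<or> pol t = (pol r)\<^sup>2 - (pol l)\<^sup>2"
    "length (labs l) + length (labs r) = 4" "1 \<le> length (labs l)"
      "length (labs l) \<le> length (labs r)"
    by (rule tree_split_le[OF assms(1,2)]) auto
  show thesis
  proof (cases "length (labs l) = 1")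
    case True
    then obtain c where c: "l = Leaf c" using lr leaf_shape by blast
    have "length (labs r) = 3" using lr(7) True by simp
    then obtain i d c' where d: "1 \<le> d" and r: "(pol r)\<^sup>2
      = [:trip_cst d i c', trip_lin d i c', 4 * (d * d) - 1:]\<^sup>2"
      using trip_shape[OF lr(2)] by metis
    have "coeff ((pol r)\<^sup>2 - (pol l)\<^sup>2) 4 = (4 * (d * d) - 1) * (4 * (d * d) - 1)"
      unfolding r by (simp add: c square_linear square_quadratic numeral_eq_Suc)
    moreover have "coeff (pol t) 4 = 0" using assms(3) by (intro coeff_eq_0) simp
    ultimately have "4 * (d * d) = 1" using lr(6) by auto
    then show thesis by presburger
  next
    case False
    then have "length (labs l) = 2" "length (labs r) = 2" using lr by auto
    then obtain i d j e where "0 \<le> i" "1 \<le> d" "i + d \<le> 11" "set (labs l) = set [i, i + d]"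
       "(pol l)\<^sup>2 = (pair_poly i d)\<^sup>2" "0 \<le> j" "1 \<le> e" "j + e \<le> 11" "set (labs r) = set [j, j + e]"
       "(pol r)\<^sup>2 = (pair_poly j e)\<^sup>2"
      using pair_shape lr(1,2) by metis
    then show thesis using that[of i d j e] lr(3,4,5) by auto
  qed
qed

lemma diff_pair_polys: "(pair_poly i d)\<^sup>2 - (pair_poly j e)\<^sup>2 =
  [:d * d * ((2 * i + d) * (2 * i + d)) - e * e * ((2 * j + e) * (2 * j + e)),
    4 * (d * d * (2 * i + d) - e * e * (2 * j + e)), 4 * (d * d - e * e):]"
  by (simp add: pair_poly_def square_linear algebra_simps)

text \<open>If the two pairs of a quadruple have the same gap, the quadratic terms cancel. The labels then
  form a parallelogram \<open>i, i + d, i + e, i + d + e\<close>.\<close>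

lemma diff_parallel_pairs:
  "((pair_poly i d)\<^sup>2 - (pair_poly (i + e) d)\<^sup>2)\<^sup>2
    = [:4 * (d * d * e) * (2 * i + d + e), 8 * (d * d * e):]\<^sup>2"
proof -
  have "(pair_poly i d)\<^sup>2 - (pair_poly (i + e) d)\<^sup>2
    = - [:4 * (d * d * e) * (2 * i + d + e), 8 * (d * d * e):]"
    unfolding diff_pair_polys by (simp add: algebra_simps)
  then show ?thesis by (simp only: power2_minus)
qed

lemma parallelogram_shape:
  assumes "admissible t" "length (labs t) = 4" "degree (pol t) \<le> 1"
  obtains i d e where "0 \<le> i" "1 \<le> d" "1 \<le> e" "d \<noteq> e" "i + d + e \<le> 11"
    "distinct [i, i + d, i + e, i + d + e]" "set (labs t) = set [i, i + d, i + e, i + d + e]"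
    "(pol t)\<^sup>2 = [:4 * (d * d * e) * (2 * i + d + e), 8 * (d * d * e):]\<^sup>2"
proof -
  obtain i d j e where *: "0 \<le> i" "1 \<le> d" "i + d \<le> 11" "0 \<le> j" "1 \<le> e" "j + e \<le> 11"
    "distinct [i, i + d, j, j + e]" "set (labs t) = set [i, i + d, j, j + e]"
    "(pol t)\<^sup>2 = ((pair_poly i d)\<^sup>2 - (pair_poly j e)\<^sup>2)\<^sup>2"
  proof (rule quad_shape[OF assms(1,2)])
    show "degree (pol t) \<le> 3" using assms(3) by simp
  qed blast
  have "coeff ((pol t)\<^sup>2) (2 * 2) = 0"
    using assms(3) by (intro coeff_eq_0) (auto simp: degree_power_eq intro: le_less_trans[OF
      degree_power_le])
  then have "d * d = e * e"
    unfolding *(9) diff_pair_polys square_quadratic by (simp add: numeral_eq_Suc)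
  then have "e = d" using *(2,5) by (simp flip: power2_eq_square)
  note obtained = that
  have main: thesis
    if ij: "0 \<le> i" "j + d \<le> 11" "i < j" "distinct [i, i + d, j, j + d]"
      "set (labs t) = set [i, i + d, j, j + d]"
      "(pol t)\<^sup>2 = ((pair_poly i d)\<^sup>2 - (pair_poly j d)\<^sup>2)\<^sup>2" for i j
  proof -
    define e where "e = j - i"
    have j: "j = i + e" by (simp add: e_def)
    have c: "i + e + d = i + d + e" by simp
    show thesis
      using obtained[of i d e] ij *(2) unfolding j diff_parallel_pairs c by auto
  qed
  show thesis
  proof (cases "i < j")
    case True
    then show thesis using main[of i j] * \<open>e = d\<close> by simp
  next
    case False
    have "distinct [j, j + d, i, i + d]" "set (labs t) = set [j, j + d, i, i + d]"
      "(pol t)\<^sup>2 = ((pair_poly j d)\<^sup>2 - (pair_poly i d)\<^sup>2)\<^sup>2" "j < i"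
      using *(7,8,9) \<open>e = d\<close> False by (auto simp: power2_commute)
    then show thesis
      using main[of j i] *(1-6) \<open>e = d\<close> by simp
  qed
qed

lemma parallelogram_square:
  "[:4 * (d * d * e) * (2 * i + d + e), 8 * (d * d * e):]\<^sup>2 =
    [:16 * ((d * d * e) * (d * d * e) * ((2 * i + d + e) * (2 * i + d + e))),
      64 * ((d * d * e) * (d * d * e) * (2 * i + d + e)), 64 * ((d * d * e) * (d * d * e)):]" for
        d e i :: int
  by (simp add: square_linear)

text \<open>The polynomial of a quadruple made of the pairs \<open>i, i + d\<close> and \<open>j, j + e\<close> has the constant
  coefficient \<open>quad_cst d i e j\<close>, the linear coefficient \<open>4 * quad_lin d i e j\<close> and the leading
  coefficient \<open>4 (d\<^sup>2 - e\<^sup>2)\<close>.\<close>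

definition quad_cst :: "int \<Rightarrow> int \<Rightarrow> int \<Rightarrow> int \<Rightarrow> int" where
  "quad_cst d i e j = d * d * ((2 * i + d) * (2 * i + d)) - e * e * ((2 * j + e) * (2 * j + e))"

definition quad_lin :: "int \<Rightarrow> int \<Rightarrow> int \<Rightarrow> int \<Rightarrow> int" where
  "quad_lin d i e j = d * d * (2 * i + d) - e * e * (2 * j + e)"

lemma ordered_quad_shape:
  assumes "admissible t" "length (labs t) = 4" "degree (pol t) \<le> 3"
  obtains i d j e where "0 \<le> i" "1 \<le> d" "i + d \<le> 11" "0 \<le> j" "1 \<le> e" "j + e \<le> 11" "e \<le> d"
    "distinct [i, i + d, j, j + e]" "set (labs t) = set [i, i + d, j, j + e]"
    "(pol t)\<^sup>2 = [:quad_cst d i e j, 4 * quad_lin d i e j, 4 * (d * d - e * e):]\<^sup>2"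
proof -
  obtain i d j e where *: "0 \<le> i" "1 \<le> d" "i + d \<le> 11" "0 \<le> j" "1 \<le> e" "j + e \<le> 11"
    "distinct [i, i + d, j, j + e]" "set (labs t) = set [i, i + d, j, j + e]"
    "(pol t)\<^sup>2 = ((pair_poly i d)\<^sup>2 - (pair_poly j e)\<^sup>2)\<^sup>2"
    by (rule quad_shape[OF assms])
  show thesis
  proof (cases "e \<le> d")
    case True
    then show thesis
      using that[of i d j e] * by (simp add: diff_pair_polys quad_cst_def quad_lin_def)
  next
    case False
    have "(pol t)\<^sup>2 = ((pair_poly j e)\<^sup>2 - (pair_poly i d)\<^sup>2)\<^sup>2" using *(9)
      by (simp add: power2_commute)
    moreover have "distinct [j, j + e, i, i + d]" "set (labs t) = set [j, j + e, i, i + d]"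
      using *(7,8) by auto
    ultimately show thesis
      using that[of j e i d] *(1-6) False by (simp add: diff_pair_polys quad_cst_def quad_lin_def)
  qed
qed

text \<open>In a parallelogram with \<open>d = e\<close> two labels would coincide, so \<open>d\<^sup>2e = 1\<close> does not occur.\<close>

lemma parallelogram_area_bounds:
  fixes d e :: int
  assumes "1 \<le> d" "1 \<le> e" "d \<noteq> e"
  shows "2 \<le> d * d * e" "d * d * e \<le> 4 \<Longrightarrow> d \<le> 2 \<and> e \<le> 4"
proof -
  have dd: "d * d \<ge> n * n" if "n \<le> d" "0 \<le> n" for n
    using that by (intro mult_mono) auto
  have e: "d * d * e \<ge> d * d * 1" "d * d * e \<ge> 1 * e"
    using assms dd[of 1] by (intro mult_left_mono mult_right_mono; simp)+
  show "2 \<le> d * d * e"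
  proof (cases "d = 1")
    case False
    then have "4 \<le> d * d" using assms(1) dd[of 2] by simp
    then show ?thesis using e(1) by linarith
  qed (use assms in simp)
  show "d \<le> 2 \<and> e \<le> 4" if "d * d * e \<le> 4"
  proof
    show "e \<le> 4" using that e(2) by linarith
    show "d \<le> 2" using that e(1) dd[of 3] by linarith
  qed
qed

text \<open>Three concentric pairs with gaps 6, 8 and 10 satisfy \<open>P\<^sup>2 + Q\<^sup>2 = R\<^sup>2\<close>, so a vanishing tree on
  the other six labels would complete them to a relation. It does not exist because the labels
  inside the tree are distinct. Equal squares of a leaf and a larger tree contradict the parity
  of the linear coefficients. A pair with the same square as a parallelogram has gap 8, the
  parallelogram has \<open>d = 1\<close> and \<open>e = 2\<close>, and the midpoints are respectively an integer and a half-integer.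
  For two triples with equal squares \<open>parallel_trips\<close> applies, and their constant coefficients differ.\<close>

lemma pol_nonzero_6:
  assumes "admissible t" "length (labs t) = 6"
  shows "pol t \<noteq> 0"
proof
  assume zero: "pol t = 0"
  obtain l r where lr: "admissible l" "admissible r" "set (labs l) \<inter> set (labs r) = {}"
    "pol t = (pol l)\<^sup>2 - (pol r)\<^sup>2 \<or> pol t = (pol r)\<^sup>2 - (pol l)\<^sup>2"
    "length (labs l) + length (labs r) = 6" "1 \<le> length (labs l)"
      "length (labs l) \<le> length (labs r)"
    by (rule tree_split_le[OF assms]) auto
  have eq: "(pol l)\<^sup>2 = (pol r)\<^sup>2" using lr(4) zero by auto
  note par = leaf_iff_of_squares_eq[OF eq]
  consider "length (labs l) = 1" | "length (labs l) = 2" "length (labs r) = 4"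
    | "length (labs l) = 3" "length (labs r) = 3" using lr by linarith
  then show False
  proof cases
    case 1
    then show False using par lr by simp
  next
    case 2
    obtain j p where l: "0 \<le> j" "1 \<le> p" "j + p \<le> 11" "(pol l)\<^sup>2 = (pair_poly j p)\<^sup>2"
      using pair_shape[OF lr(1) 2(1)] by metis
    have "degree (pol r) \<le> 1"
      by (rule degree_le_1_square) (simp add: eq[symmetric] l(4) pair_poly_def square_linear)
    then obtain i d e where r: "0 \<le> i" "1 \<le> d" "1 \<le> e" "d \<noteq> e" "i + d + e \<le> 11"
      "(pol r)\<^sup>2 = [:4 * (d * d * e) * (2 * i + d + e), 8 * (d * d * e):]\<^sup>2"
      using parallelogram_shape[OF lr(2) 2(2)] by metis
    define D where "D = d * d * e"
    have D: "2 \<le> D" unfolding D_def using parallelogram_area_bounds(1) r by auto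
    have "[:p * (2 * j + p), 2 * p:]\<^sup>2 = [:4 * D * (2 * i + d + e), 8 * D:]\<^sup>2"
      using eq unfolding l(4) r(6) pair_poly_def D_def .
    then have "[:p * (2 * j + p), 2 * p:] = [:4 * D * (2 * i + d + e), 8 * D:]
      \<or> [:p * (2 * j + p), 2 * p:] = - [:4 * D * (2 * i + d + e), 8 * D:]"
        by (simp only: power2_eq_iff)
    then have p: "p = 4 * D" "p * (2 * j + p) = 4 * D * (2 * i + d + e)"
      using D l(2) by auto
    then have "2 * j + p = 2 * i + d + e" using D by simp
    moreover have "D = 2" using p(1) l D by simp
    moreover have "d = 1"
    proof (rule ccontr)
      assume "d \<noteq> 1"
      then have "d = 2" using parallelogram_area_bounds(2)[of d e] r \<open>D = 2\<close> unfolding D_def by auto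
      then show False using \<open>D = 2\<close> r(3) unfolding D_def by simp
    qed
    moreover have "e = 2" using \<open>d = 1\<close> \<open>D = 2\<close> D_def by simp
    ultimately show False using p(1) by presburger
  next
    case 3
    obtain i d c where l: "1 \<le> d" "0 \<le> c" "c \<le> 11" "distinct [i, i + d, c]"
      "set (labs l) = set [i, i + d, c]" "(pol l)\<^sup>2
        = [:trip_cst d i c, trip_lin d i c, 4 * (d * d) - 1:]\<^sup>2"
      using trip_shape[OF lr(1) 3(1)] by metis
    obtain i' d' c' where r: "1 \<le> d'" "0 \<le> c'" "c' \<le> 11" "distinct [i', i' + d', c']"
      "set (labs r) = set [i', i' + d', c']" "(pol r)\<^sup>2
        = [:trip_cst d' i' c', trip_lin d' i' c', 4 * (d' * d') - 1:]\<^sup>2"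
      using trip_shape[OF lr(2) 3(2)] by metis
    from eq l(6) r(6) have "[:trip_cst d i c, trip_lin d i c, 4 * (d * d) - 1:]
      = [:trip_cst d' i' c', trip_lin d' i' c', 4 * (d' * d') - 1:]
      \<or> [:trip_cst d i c, trip_lin d i c, 4 * (d * d) - 1:]
        = - [:trip_cst d' i' c', trip_lin d' i' c', 4 * (d' * d') - 1:]"
      by (simp only: power2_eq_iff)
    then have e: "4 * (d * d) - 1 = 4 * (d' * d') - 1" "trip_lin d i c = trip_lin d' i' c'"
      "trip_cst d i c = trip_cst d' i' c'"
      using trip_lead_pos[OF l(1)] trip_lead_pos[OF r(1)] by auto
    then have "d' = d" using trip_lead_inj l(1) r(1) by metis
    have "distinct [i, i + d, c, i', i' + d, c']"
      using lr(3) l(4,5) r(4,5) unfolding \<open>d' = d\<close> by auto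
    then have *: "d = 1" "\<bar>i - i'\<bar> = 2" "c' = c - 4 * (i - i')"
      using parallel_trips l(1-3) r(1-3) e(2) \<open>d' = d\<close> by metis+
    from *(2) consider "i = i' + 2" | "i = i' - 2" by linarith
    then show False
    proof cases
      case 1
      with e(3) * \<open>d' = d\<close> have "16 * i' + 24 = 16 * c - 64"
        by (simp add: trip_cst_def algebra_simps)
      then show False by presburger
    next
      case 2
      with e(3) * \<open>d' = d\<close> have "16 * i' - 8 = 16 * c + 64"
        by (simp add: trip_cst_def algebra_simps)
      then show False by presburger
    qed
  qed
qed

section \<open>Bounded search\<close>

text \<open>The integer problems that remain have bounded variables and are decided by nested loops
  that the simplifier runs. Tests that prune a loop are written as conditionals and not as conjunctions
  or implications, because the simplifier evaluates the test of a conditional before it looks at the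
  branches; this is what cuts the loops short.\<close>

primrec all_distinct :: "int list \<Rightarrow> bool" where
 "all_distinct [] = True"
|"all_distinct (x # xs) = (if list_all (\<lambda>y. x \<noteq> y) xs then all_distinct xs else False)"

lemma all_distinct_iff: "all_distinct xs \<longleftrightarrow> distinct xs"
  by (induction xs) (auto simp: list_all_iff)

definition all_upto :: "int \<Rightarrow> int \<Rightarrow> (int \<Rightarrow> bool) \<Rightarrow> bool" where
  "all_upto m n P = list_all P [m..n]"

lemma all_uptoD: "all_upto m n P \<Longrightarrow> m \<le> x \<Longrightarrow> x \<le> n \<Longrightarrow> P x"
  by (simp add: all_upto_def list_all_iff)

lemma all_upto_iff: "all_upto m n P \<longleftrightarrow> (\<forall>x. m \<le> x \<and> x \<le> n \<longrightarrow> P x)"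
  by (auto simp: all_upto_def list_all_iff)

section \<open>Integer obstructions for pairs, triples and quadruples\<close>

text \<open>Both \<open>d\<^sup>2\<close> modulo 4 and \<open>(d (2i + d))\<^sup>2\<close> modulo 8 are the parity \<open>r\<close> of \<open>d\<close>: for odd \<open>d\<close> the second
  is the square of an odd number, for even \<open>d\<close> the square of a multiple of 4.\<close>

lemma square_residues:
  obtains x y r where "d * d = 4 * x + r" "d * d * ((2 * i + d) * (2 * i + d)) = 8 * y + r"
    "r \<in> {0, 1 :: int}"
proof (cases "even d")
  case True
  then obtain u where d: "d = 2 * u" by blast
  show thesis
    by (rule that[of "u * u" 0 "2 * (u * (u + i)) * (u * (u + i))"]) (simp_all add: d algebra_simps)
next
  case False
  then obtain u where d: "d = 2 * u + 1" by (elim oddE)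
  define w where "w = (2 * u + 1) * (u + i) + u"
  have "even (w * (w + 1))" by simp
  then obtain y where y: "w * (w + 1) = 2 * y" by blast
  have "d * (2 * i + d) = 2 * w + 1" by (simp add: d w_def algebra_simps)
  then have "d * d * ((2 * i + d) * (2 * i + d)) = (2 * w + 1) * (2 * w + 1)"
    by (metis mult.assoc mult.left_commute)
  also have "\<dots> = 4 * (w * (w + 1)) + 1" by (simp add: algebra_simps)
  finally have sq: "d * d * ((2 * i + d) * (2 * i + d)) = 8 * y + 1" using y by simp
  have "d * d = 4 * (u * u + u) + 1" by (simp add: d algebra_simps)
  then show thesis by (rule that[OF _ sq]) simp
qed

text \<open>Modulo 4 the hypothesis compares the differences of two parities, so these differences are
  equal integers, and modulo 8 the constants are the same differences.\<close>

lemma eight_dvd_quad_cst_diff: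
  assumes "d * d - e * e = d' * d' - e' * e'"
  shows "8 dvd quad_cst d i e j - quad_cst d' i' e' j'"
proof -
  obtain x1 y1 r1 where 1: "d * d = 4 * x1 + r1" "d * d * ((2 * i + d) * (2 * i + d))
    = 8 * y1 + r1" "r1 \<in> {0, 1}"
    by (rule square_residues)
  obtain x2 y2 r2 where 2: "e * e = 4 * x2 + r2" "e * e * ((2 * j + e) * (2 * j + e))
    = 8 * y2 + r2" "r2 \<in> {0, 1}"
    by (rule square_residues)
  obtain x3 y3 r3 where 3: "d' * d' = 4 * x3 + r3" "d' * d' * ((2 * i' + d') * (2 * i' + d'))
    = 8 * y3 + r3" "r3 \<in> {0, 1}"
    by (rule square_residues)
  obtain x4 y4 r4 where 4: "e' * e' = 4 * x4 + r4" "e' * e' * ((2 * j' + e') * (2 * j' + e'))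
    = 8 * y4 + r4" "r4 \<in> {0, 1}"
    by (rule square_residues)
  have "4 * x1 + r1 - (4 * x2 + r2) = 4 * x3 + r3 - (4 * x4 + r4)"
    using assms 1(1) 2(1) 3(1) 4(1) by linarith
  moreover have "0 \<le> r1" "r1 \<le> 1" "0 \<le> r2" "r2 \<le> 1" "0 \<le> r3" "r3 \<le> 1" "0 \<le> r4" "r4 \<le> 1"
    using 1(3) 2(3) 3(3) 4(3) by auto
  ultimately have "r1 - r2 = r3 - r4" by presburger
  then have "quad_cst d i e j - quad_cst d' i' e' j' = 8 * (y1 - y2 - y3 + y4)"
    unfolding quad_cst_def 1(2) 2(2) 3(2) 4(2) by simp
  then show ?thesis by simp
qed

definition quad_leads_check where "quad_leads_check \<longleftrightarrow>
  all_upto 2 6 (\<lambda>d. all_upto 1 (d - 1) (\<lambda>e. all_upto 2 6 (\<lambda>d'. all_upto 1 (d' - 1) (\<lambda>e'.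
    if d * d - e * e = d' * d' - e' * e' then
      if d * d - e * e \<le> 7 then d = d' \<and> e = e' \<and> e = d - 1 \<and> d \<le> 4 else True else True))))"

definition quads_check where "quads_check \<longleftrightarrow>
  all_upto 2 4 (\<lambda>d. all_upto (-11) 11 (\<lambda>k. all_upto (-11) 11 (\<lambda>l.
    if k = 0 then True else if d * d * k = (d - 1) * (d - 1) * l then
      all_upto 0 (11 - d) (\<lambda>i. all_upto 0 (12 - d) (\<lambda>j.
        if all_distinct [i, i + d, j, j + (d - 1), i + k, i + k + d, j + l, j + l + (d - 1)] then
          (let c = quad_cst d (i + k) (d - 1) (j + l) - quad_cst d i (d - 1) j in
            if c = 0 then True else 2 * ((d * d - (d - 1) * (d - 1)) * \<bar>c\<bar>) > 120) else True))
              else True)))"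

lemma quad_leads_check: quad_leads_check by code_simp

lemma quads_check: quads_check by code_simp

text \<open>Two quadruples that agree except in the constant coefficient have squares that differ by a
  polynomial with leading coefficient \<open>8 (d\<^sup>2 - e\<^sup>2)\<close> times the difference of the constants. It
  should be compensated by two pairs, whose gaps satisfy \<open>\<bar>q\<^sup>2 - p\<^sup>2\<bar> \<le> 11\<^sup>2 - 1 = 120\<close>; this is where
  the bound comes from. Since 8 divides the difference of the constants, a violation would force
  \<open>d\<^sup>2 - e\<^sup>2 \<le> 7\<close>, so the gaps are \<open>2, 1\<close> or \<open>3, 2\<close> or \<open>4, 3\<close> in both quadruples, and a search over the
  positions decides.\<close>

lemma quad_constants_far_apart:
  assumes d: "1 \<le> e" "e < d" "1 \<le> e'" "e' < d'"
    and r: "0 \<le> i" "i + d \<le> 11" "0 \<le> j" "j + e \<le> 11" "0 \<le> i'" "i' + d' \<le> 11" "0 \<le> j'" "j' + e' \<le> 11"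
    and dst: "distinct [i, i + d, j, j + e, i', i' + d', j', j' + e']"
    and lead: "d * d - e * e = d' * d' - e' * e'"
    and lin_eq: "quad_lin d i e j = quad_lin d' i' e' j'"
    and ne: "quad_cst d i e j \<noteq> quad_cst d' i' e' j'"
  shows "2 * ((d * d - e * e) * \<bar>quad_cst d i e j - quad_cst d' i' e' j'\<bar>) > 120"
proof (rule ccontr)
  let ?D = "d * d - e * e" and ?K = "quad_cst d i e j - quad_cst d' i' e' j'"
  assume "\<not> ?thesis"
  then have small: "?D * \<bar>?K\<bar> \<le> 60" by simp
  have grow: "y + x \<le> x * x - y * y" if "0 \<le> y" "y < x" for x y :: int
    using mult_right_mono[of 1 "x - y" "x + y"] that by (simp add: algebra_simps)
  have ge: "e + d \<le> ?D" "e' + d' \<le> ?D"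
    using grow[of e d] grow[of e' d'] d lead by auto
  have "8 \<le> \<bar>?K\<bar>"
    using eight_dvd_quad_cst_diff[OF lead, of i j i' j'] ne
    by (metis abs_numeral dvd_imp_le_int eq_iff_diff_eq_0)
  then have "?D * 8 \<le> ?D * \<bar>?K\<bar>" using ge d by (intro mult_left_mono) auto
  then have "?D * 8 \<le> 60" using small by (rule order_trans)
  then have "x \<le> 7" if "x = ?D" for x unfolding that[symmetric] by simp
  then have "?D \<le> 7" by blast
  with ge have le: "d \<le> 6" "d' \<le> 6" using d by auto
  have "d = d' \<and> e = e' \<and> e = d - 1 \<and> d \<le> 4"
  proof -
    from quad_leads_check[unfolded quad_leads_check_def, THEN all_uptoD, of d, THEN all_uptoD, of e,
        THEN all_uptoD, of d', THEN all_uptoD, of e'] show ?thesis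
      using d le lead \<open>?D \<le> 7\<close> by simp
  qed
  then have eqs: "d' = d" "e' = d - 1" "e = d - 1" "d \<le> 4" by auto
  define k l where "k = i - i'" "l = j - j'"
  then have ij: "i = i' + k" "j = j' + l" by auto
  have kl: "k \<noteq> 0" "\<bar>k\<bar> \<le> 11" "\<bar>l\<bar> \<le> 11" using r dst d unfolding ij eqs by auto
  have lin': "d * d * k = (d - 1) * (d - 1) * l"
    using lin_eq unfolding quad_lin_def ij eqs by (simp add: algebra_simps)
  from quads_check[unfolded quads_check_def, THEN all_uptoD, of d, THEN all_uptoD, of k,
      THEN all_uptoD, of l]
  have "all_upto 0 (11 - d) (\<lambda>i. all_upto 0 (12 - d) (\<lambda>j.
        if all_distinct [i, i + d, j, j + (d - 1), i + k, i + k + d, j + l, j + l + (d - 1)] then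
          (let c = quad_cst d (i + k) (d - 1) (j + l) - quad_cst d i (d - 1) j in
            if c = 0 then True else 2 * ((d * d - (d - 1) * (d - 1)) * \<bar>c\<bar>) > 120) else True))"
    using kl lin' d eqs by (simp only: if_False if_True)
  from this[THEN all_uptoD, of i', THEN all_uptoD, of j'] show False
    using r dst ne small unfolding ij eqs by (auto simp: all_distinct_iff Let_def)
qed

definition shift_bound_check where "shift_bound_check \<longleftrightarrow> all_upto 1 11 (\<lambda>p. p * p * (11 - p) \<le> 196)"

definition equal_parallelograms_check where "equal_parallelograms_check \<longleftrightarrow>
  all_upto 1 2 (\<lambda>d. all_upto 1 4 (\<lambda>e. all_upto 1 2 (\<lambda>d'. all_upto 1 4 (\<lambda>e'.
   if d \<noteq> e \<and> d' \<noteq> e' \<and> d * d * e \<le> 4 \<and> d * d * e = d' * d' * e' then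
    all_upto 1 11 (\<lambda>p. all_upto (p - 11) (11 - p) (\<lambda>k. if k = 0 then True else
     all_upto (-6) 6 (\<lambda>t. if 8 * ((d * d * e) * (d * d * e) * t) = p * p * k then
      all_upto 0 11 (\<lambda>i. all_upto 0 11 (\<lambda>i'. if t = 2 * i' + d' + e' - (2 * i + d + e) then
       all_upto 0 11 (\<lambda>iP. \<not> all_distinct [iP, iP + p, iP - k, iP - k + p, i, i + d, i + e, i + d
         + e, i', i' + d', i' + e', i' + d' + e'])
       else True)) else True))) else True))))"

definition unequal_parallelograms_check where "unequal_parallelograms_check \<longleftrightarrow>
  all_upto 1 2 (\<lambda>d. all_upto 1 4 (\<lambda>e. all_upto 1 2 (\<lambda>d'. all_upto 1 4 (\<lambda>e'.
   if d \<noteq> e \<and> d' \<noteq> e' \<and> d * d * e \<le> 4 \<and> d' * d' * e' \<le> 4 \<and> d * d * e \<noteq> d' * d' * e' then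
    all_upto 1 11 (\<lambda>p. all_upto 1 11 (\<lambda>q. 
     if p * p + 16 * ((d * d * e) * (d * d * e))
       = q * q + 16 * ((d' * d' * e') * (d' * d' * e')) then
      all_upto 0 (11 - p) (\<lambda>iP. all_upto 0 (11 - q) (\<lambda>iQ. all_upto 0 (11 - d - e) (\<lambda>i.
        all_upto 0 (11 - d' - e') (\<lambda>i'. 
        if p * p * (2 * iP + p) + 16 * ((d * d * e) * (d * d * e) * (2 * i + d + e))
          = q * q * (2 * iQ + q) + 16 * ((d' * d' * e') * (d' * d' * e') * (2 * i' + d' + e')) then
         (if all_distinct [iP, iP + p, iQ, iQ + q, i, i + d, i + e, i + d + e, i', i' + d', i' +
           e', i' + d' + e'] then
           p * p * ((2 * iP + p) * (2 * iP + p)) + 16 * ((d * d * e) * (d * d * e) * ((2 * i + d +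
             e) * (2 * i + d + e)))
           \<noteq> q * q * ((2 * iQ + q) * (2 * iQ + q)) + 16 * ((d' * d' * e') * (d' * d' * e') * ((2 *
             i' + d' + e') * (2 * i' + d' + e'))) else True)
        else True)))) else True)) else True))))"

lemma shift_bound_check: shift_bound_check by code_simp

lemma equal_parallelograms_check: equal_parallelograms_check by code_simp

lemma unequal_parallelograms_check: unequal_parallelograms_check by code_simp

text \<open>Consecutive squares \<open>(x - 1)\<^sup>2\<close> and \<open>x\<^sup>2\<close> differ by \<open>2x - 1\<close>.\<close>

lemma square_gap: "0 \<le> y \<Longrightarrow> y < x \<Longrightarrow> 2 * x - 1 \<le> x * x - y * y" for x y :: int
  using mult_mono[of y "x - 1" y "x - 1"] by (simp add: algebra_simps)

text \<open>A pair and a parallelogram on either side. Put \<open>D = d\<^sup>2e\<close> and \<open>E = d'\<^sup>2e'\<close>; the leading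
  coefficients give \<open>16 (D\<^sup>2 - E\<^sup>2) = q\<^sup>2 - p\<^sup>2\<close>. If \<open>D \<noteq> E\<close>, the bound \<open>\<bar>q\<^sup>2 - p\<^sup>2\<bar> \<le> 120\<close> makes both at
  most 4. If \<open>D = E\<close>, then \<open>p = q\<close> and the linear coefficients give \<open>p\<^sup>2k = 8D\<^sup>2t\<close> where the
  nonzero \<open>k\<close> is the difference of the midpoints of the pairs and \<open>t\<close> is twice the difference of
  the midpoints of the parallelograms. Since \<open>p\<^sup>2 (11 - p) \<le> 196\<close> bounds the left side, again
  \<open>D \<le> 4\<close>. The remaining cases are searched.\<close>

lemma pairs_and_parallelograms_differ:
  fixes p q d e d' e' iP iQ i i' :: int
  assumes d: "1 \<le> d" "1 \<le> e" "d \<noteq> e" "1 \<le> d'" "1 \<le> e'" "d' \<noteq> e'" "1 \<le> p" "1 \<le> q"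
    and r: "0 \<le> i" "i + d + e \<le> 11" "0 \<le> i'" "i' + d' + e' \<le> 11"
      "0 \<le> iP" "iP + p \<le> 11" "0 \<le> iQ" "iQ + q \<le> 11"
    and dst: "distinct [iP, iP + p, iQ, iQ + q, i, i + d, i + e, i + d + e, i', i' + d', i' + e',
      i' + d' + e']"
    and e0: "p * p + 16 * ((d * d * e) * (d * d * e))
      = q * q + 16 * ((d' * d' * e') * (d' * d' * e'))"
    and e1: "p * p * (2 * iP + p) + 16 * ((d * d * e) * (d * d * e) * (2 * i + d + e))
      = q * q * (2 * iQ + q) + 16 * ((d' * d' * e') * (d' * d' * e') * (2 * i' + d' + e'))"
    and e2: "p * p * ((2 * iP + p) * (2 * iP + p)) + 16 * ((d * d * e) * (d * d * e) * ((2 * i + d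
      + e) * (2 * i + d + e)))
      = q * q * ((2 * iQ + q) * (2 * iQ + q)) + 16 * ((d' * d' * e') * (d' * d' * e') * ((2 * i' +
        d' + e') * (2 * i' + d' + e')))"
  shows False
proof -
  define D E where DE: "D = d * d * e" "E = d' * d' * e'"
  have ge2: "2 \<le> D" "2 \<le> E" unfolding DE using parallelogram_area_bounds(1) d by auto
  have pq: "p \<le> 11" "q \<le> 11" using r by auto
  show False
  proof (cases "D = E")
    case True
    then have "p * p = q * q" using e0 DE by simp
    then have "q = p" using d by (simp flip: power2_eq_square)
    define k t where kt: "k = iP - iQ" "t = (2 * i' + d' + e') - (2 * i + d + e)"
    then have iQ: "iQ = iP - k" by simp
    have k: "k \<noteq> 0" "\<bar>k\<bar> \<le> 11 - p" using dst r unfolding iQ \<open>q = p\<close> by auto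
    have eq: "8 * (D * D * t) = p * p * k"
      using e1 True unfolding DE[symmetric] kt \<open>q = p\<close> by (simp add: algebra_simps)
    then have "t \<noteq> 0" using k d by auto
    have "8 * (D * D * \<bar>t\<bar>) = p * p * \<bar>k\<bar>"
      using arg_cong[OF eq, of abs] by (simp add: abs_mult)
    also have "\<dots> \<le> p * p * (11 - p)" using k by (intro mult_left_mono) auto
    also have "\<dots> \<le> 196"
      using shift_bound_check[unfolded shift_bound_check_def, THEN all_uptoD, of p] d pq by simp
    finally have le: "8 * (D * D * \<bar>t\<bar>) \<le> 196" .
    have "D * D * 1 \<le> D * D * \<bar>t\<bar>" using \<open>t \<noteq> 0\<close> by (intro mult_left_mono) auto
    moreover have "5 * 5 \<le> D * D" if "5 \<le> D" using that by (intro mult_mono) auto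
    ultimately have "D \<le> 4" using le by linarith
    have "2 * 2 \<le> D * D" using ge2 by (intro mult_mono) auto
    then have "4 * \<bar>t\<bar> \<le> D * D * \<bar>t\<bar>" by (intro mult_right_mono) auto
    then have "\<bar>t\<bar> \<le> 6" using le by linarith
    have small: "d \<le> 2 \<and> e \<le> 4" "d' \<le> 2 \<and> e' \<le> 4"
      using parallelogram_area_bounds(2)[of d e] parallelogram_area_bounds(2)[of d' e'] d \<open>D \<le> 4\<close>
        True unfolding DE by auto
    from equal_parallelograms_check[unfolded equal_parallelograms_check_def, THEN all_uptoD, of d,
      THEN all_uptoD, of e,
        THEN all_uptoD, of d', THEN all_uptoD, of e']
    have "all_upto 1 11 (\<lambda>p. all_upto (p - 11) (11 - p) (\<lambda>k. if k = 0 then True else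
     all_upto (-6) 6 (\<lambda>t. if 8 * ((d * d * e) * (d * d * e) * t) = p * p * k then
      all_upto 0 11 (\<lambda>i. all_upto 0 11 (\<lambda>i'. if t = 2 * i' + d' + e' - (2 * i + d + e) then
       all_upto 0 11 (\<lambda>iP. \<not> all_distinct [iP, iP + p, iP - k, iP - k + p, i, i + d, i + e, i + d
         + e, i', i' + d', i' + e', i' + d' + e'])
       else True)) else True)))"
      using d small \<open>D \<le> 4\<close> True unfolding DE by simp
    from this[THEN all_uptoD, of p, THEN all_uptoD, of k]
    have "all_upto (-6) 6 (\<lambda>t. if 8 * ((d * d * e) * (d * d * e) * t) = p * p * k then
      all_upto 0 11 (\<lambda>i. all_upto 0 11 (\<lambda>i'. if t = 2 * i' + d' + e' - (2 * i + d + e) then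
       all_upto 0 11 (\<lambda>iP. \<not> all_distinct [iP, iP + p, iP - k, iP - k + p, i, i + d, i + e, i + d
         + e, i', i' + d', i' + e', i' + d' + e'])
       else True)) else True)"
      using d pq k by simp
    from this[THEN all_uptoD, of t]
    have "all_upto 0 11 (\<lambda>i. all_upto 0 11 (\<lambda>i'. if t = 2 * i' + d' + e' - (2 * i + d + e) then
       all_upto 0 11 (\<lambda>iP. \<not> all_distinct [iP, iP + p, iP - k, iP - k + p, i, i + d, i + e, i + d
         + e, i', i' + d', i' + e', i' + d' + e'])
       else True))"
      using eq \<open>\<bar>t\<bar> \<le> 6\<close> unfolding DE by (simp only: if_True)
    from this[THEN all_uptoD, of i, THEN all_uptoD, of i']
    have "all_upto 0 11 (\<lambda>iP. \<not> all_distinct [iP, iP + p, iP - k, iP - k + p, i, i + d, i + e, i +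
      d + e, i', i' + d', i' + e', i' + d' + e'])"
      using r d kt(2) by simp
    from this[THEN all_uptoD, of iP] show False
      using r d dst unfolding all_distinct_iff iQ \<open>q = p\<close> by simp
  next
    case False
    have "\<bar>q * q - p * p\<bar> \<le> 120"
      using d pq mult_mono[of 1 p 1 p] mult_mono[of 1 q 1 q] mult_mono[of p 11 p 11] mult_mono[of
        q 11 q 11]
      by auto
    then have "\<bar>16 * (D * D) - 16 * (E * E)\<bar> \<le> 120" using e0 unfolding DE by linarith
    then have "\<bar>D * D - E * E\<bar> \<le> 7" by linarith
    then have "D \<le> 4" "E \<le> 4"
      using square_gap[of E D] square_gap[of D E] ge2 False by linarith+
    have small: "d \<le> 2 \<and> e \<le> 4" "d' \<le> 2 \<and> e' \<le> 4"
      using parallelogram_area_bounds(2)[of d e] parallelogram_area_bounds(2)[of d' e'] d \<open>D \<le> 4\<close>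
        \<open>E \<le> 4\<close> unfolding DE by auto
    from unequal_parallelograms_check[unfolded unequal_parallelograms_check_def, THEN all_uptoD,
      of d, THEN all_uptoD, of e,
        THEN all_uptoD, of d', THEN all_uptoD, of e']
    have "all_upto 1 11 (\<lambda>p. all_upto 1 11 (\<lambda>q. 
     if p * p + 16 * ((d * d * e) * (d * d * e))
       = q * q + 16 * ((d' * d' * e') * (d' * d' * e')) then
      all_upto 0 (11 - p) (\<lambda>iP. all_upto 0 (11 - q) (\<lambda>iQ. all_upto 0 (11 - d - e) (\<lambda>i.
        all_upto 0 (11 - d' - e') (\<lambda>i'. 
        if p * p * (2 * iP + p) + 16 * ((d * d * e) * (d * d * e) * (2 * i + d + e))
          = q * q * (2 * iQ + q) + 16 * ((d' * d' * e') * (d' * d' * e') * (2 * i' + d' + e')) then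
         (if all_distinct [iP, iP + p, iQ, iQ + q, i, i + d, i + e, i + d + e, i', i' + d', i' +
           e', i' + d' + e'] then
           p * p * ((2 * iP + p) * (2 * iP + p)) + 16 * ((d * d * e) * (d * d * e) * ((2 * i + d +
             e) * (2 * i + d + e)))
           \<noteq> q * q * ((2 * iQ + q) * (2 * iQ + q)) + 16 * ((d' * d' * e') * (d' * d' * e') * ((2 *
             i' + d' + e') * (2 * i' + d' + e'))) else True)
        else True)))) else True))"
      using d small \<open>D \<le> 4\<close> \<open>E \<le> 4\<close> False unfolding DE by (simp del: all_upto_iff)
    from this[THEN all_uptoD, of p, THEN all_uptoD, of q]
    have "all_upto 0 (11 - p) (\<lambda>iP. all_upto 0 (11 - q) (\<lambda>iQ. all_upto 0 (11 - d - e) (\<lambda>i.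
      all_upto 0 (11 - d' - e') (\<lambda>i'. 
        if p * p * (2 * iP + p) + 16 * ((d * d * e) * (d * d * e) * (2 * i + d + e))
          = q * q * (2 * iQ + q) + 16 * ((d' * d' * e') * (d' * d' * e') * (2 * i' + d' + e')) then
         (if all_distinct [iP, iP + p, iQ, iQ + q, i, i + d, i + e, i + d + e, i', i' + d', i' +
           e', i' + d' + e'] then
           p * p * ((2 * iP + p) * (2 * iP + p)) + 16 * ((d * d * e) * (d * d * e) * ((2 * i + d +
             e) * (2 * i + d + e)))
           \<noteq> q * q * ((2 * iQ + q) * (2 * iQ + q)) + 16 * ((d' * d' * e') * (d' * d' * e') * ((2 *
             i' + d' + e') * (2 * i' + d' + e'))) else True)
        else True))))"
      using e0 d pq by (simp only: if_True)
    from this[THEN all_uptoD, of iP, THEN all_uptoD, of iQ, THEN all_uptoD, of i, THEN all_uptoD,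
      of i']
    show False using r dst e1 e2 unfolding all_distinct_iff
      by (simp only: if_True refl not_True_eq_False) simp
  qed
qed

definition trips_quad_leads_check where "trips_quad_leads_check \<longleftrightarrow>
  all_upto 1 11 (\<lambda>a. all_upto 1 11 (\<lambda>b. if a = b then True else
   all_upto 1 11 (\<lambda>d. all_upto 1 11 (\<lambda>e. 
    (4 * (a * a) - 1) * (4 * (a * a) - 1) - (4 * (b * b) - 1) * (4 * (b * b) - 1)
      \<noteq> 16 * ((d * d - e * e) * (d * d - e * e))))))"

definition trips_parallelogram_check where "trips_parallelogram_check \<longleftrightarrow>
  all_upto 0 10 (\<lambda>i. all_upto 0 10 (\<lambda>j. if \<bar>i - j\<bar> = 2 then
   all_upto 0 11 (\<lambda>c. let E = 6 * (trip_cst 1 i c - trip_cst 1 j (c - 4 * (i - j))) in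
    all_upto 1 11 (\<lambda>p. if E + 4 * (p * p) < 1024 then
      all_upto 2 3 (\<lambda>e. if E + 4 * (p * p) = 64 * (e * e) then
       all_upto 0 (11 - p) (\<lambda>iP. all_upto 0 (10 - e)
         (\<lambda>l. \<not> all_distinct [i, i + 1, c, j, j + 1, c - 4 * (i - j), iP, iP + p, l, l + 1, l + e,
           l + 1 + e] ))
       else True) else c - 4 * (i - j) < 0 \<or> 11 < c - 4 * (i - j))) else True))"

lemma trips_quad_leads_check: trips_quad_leads_check by code_simp

lemma trips_parallelogram_check: trips_parallelogram_check by code_simp

text \<open>Two triples with the same gap on opposite sides, completed by a pair and a parallelogram. By
  \<open>parallel_trips\<close> the triples have the form \<open>i, i + 1, c\<close> and \<open>i \<plusminus> 2, i \<plusminus> 2 + 1, c \<plusminus> 8\<close>. The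
  coefficient of \<open>x\<^sup>2\<close> bounds the parallelogram: for \<open>d\<^sup>2e \<ge> 4\<close> its contribution \<open>64 (d\<^sup>2e)\<^sup>2\<close> would be
  at least 1024.\<close>

lemma trips_pair_parallelogram_differ:
  fixes a i i' c c' p iP d e l :: int
  assumes a: "1 \<le> a" "1 \<le> p" "1 \<le> d" "1 \<le> e" "d \<noteq> e"
    and r: "0 \<le> i" "i + a \<le> 11" "0 \<le> i'" "i' + a \<le> 11" "0 \<le> c" "c \<le> 11" "0 \<le> c'" "c' \<le> 11"
      "0 \<le> iP" "iP + p \<le> 11" "0 \<le> l" "l + d + e \<le> 11"
    and dst: "distinct [i, i + a, c, i', i' + a, c', iP, iP + p, l, l + d, l + e, l + d + e]"
    and e3: "trip_lin a i c = trip_lin a i' c'"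
    and e2: "2 * ((4 * (a * a) - 1) * trip_cst a i c) + 4 * (p * p)
       = 2 * ((4 * (a * a) - 1) * trip_cst a i' c') + 64 * ((d * d * e) * (d * d * e))"
  shows False
proof -
  have "distinct [i, i + a, c, i', i' + a, c']" using dst by simp
  from parallel_trips[OF a(1) r(5-8) this e3]
  have "a = 1" and two: "\<bar>i - i'\<bar> = 2" and c': "c' = c - 4 * (i - i')" by auto
  define E where "E = 6 * (trip_cst 1 i c - trip_cst 1 i' (c - 4 * (i - i')))"
  have e2': "E + 4 * (p * p) = 64 * ((d * d * e) * (d * d * e))"
    using e2 unfolding \<open>a = 1\<close> E_def c' by simp
  from trips_parallelogram_check[unfolded trips_parallelogram_check_def Let_def, THEN all_uptoD,
    of i, THEN all_uptoD, of i']
  have "all_upto 0 11 (\<lambda>c. 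
    all_upto 1 11 (\<lambda>p.
      if 6 * (trip_cst 1 i c - trip_cst 1 i' (c - 4 * (i - i'))) + 4 * (p * p) < 1024 then
      all_upto 2 3 (\<lambda>e. if 6 * (trip_cst 1 i c - trip_cst 1 i' (c - 4 * (i - i'))) + 4 * (p * p)
        = 64 * (e * e) then
       all_upto 0 (11 - p) (\<lambda>iP. all_upto 0 (10 - e)
         (\<lambda>l. \<not> all_distinct [i, i + 1, c, i', i' + 1, c - 4 * (i - i'), iP, iP + p, l, l + 1, l +
           e, l + 1 + e] ))
       else True) else c - 4 * (i - i') < 0 \<or> 11 < c - 4 * (i - i')))"
    using two r \<open>a = 1\<close> by (simp only: if_True)
  from this[THEN all_uptoD, of c, THEN all_uptoD, of p]
  have ck: "if E + 4 * (p * p) < 1024 then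
      all_upto 2 3 (\<lambda>e. if E + 4 * (p * p) = 64 * (e * e) then
       all_upto 0 (11 - p) (\<lambda>iP. all_upto 0 (10 - e)
         (\<lambda>l. \<not> all_distinct [i, i + 1, c, i', i' + 1, c', iP, iP + p, l, l + 1, l + e, l + 1 + e]
           ))
       else True) else c' < 0 \<or> 11 < c'"
    using r a unfolding E_def c' by simp
  then have lt: "E + 4 * (p * p) < 1024" using r by (auto split: if_splits)
  have "d * d * e \<le> 3"
  proof (rule ccontr)
    assume "\<not> ?thesis"
    then have "4 * 4 \<le> (d * d * e) * (d * d * e)" by (intro mult_mono) auto
    then show False using lt e2' by linarith
  qed
  then have "d \<le> 2" using parallelogram_area_bounds(2)[of d e] a by auto
  have "d = 1"
  proof (rule ccontr)
    assume "d \<noteq> 1"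
    then have "d = 2" using a \<open>d \<le> 2\<close> by simp
    then show False using \<open>d * d * e \<le> 3\<close> a by simp
  qed
  have "all_upto 2 3 (\<lambda>e. if E + 4 * (p * p) = 64 * (e * e) then
       all_upto 0 (11 - p) (\<lambda>iP. all_upto 0 (10 - e)
         (\<lambda>l. \<not> all_distinct [i, i + 1, c, i', i' + 1, c', iP, iP + p, l, l + 1, l + e, l + 1 + e]
           ))
       else True)" using ck lt by (simp only: if_True)
  from this[THEN all_uptoD, of e]
  have "all_upto 0 (11 - p) (\<lambda>iP. all_upto 0 (10 - e)
    (\<lambda>l. \<not> all_distinct [i, i + 1, c, i', i' + 1, c', iP, iP + p, l, l + 1, l + e, l + 1 + e] ))"
    using e2' a \<open>d = 1\<close> \<open>d * d * e \<le> 3\<close> by simp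
  from this[THEN all_uptoD, of iP, THEN all_uptoD, of l] show False
    using r dst unfolding all_distinct_iff \<open>a = 1\<close> \<open>d = 1\<close> by simp
qed

definition trip_leads_check where "trip_leads_check \<longleftrightarrow>
  all_upto 1 11 (\<lambda>a. all_upto 1 11 (\<lambda>b. let E
    = (4 * (a * a) - 1) * (4 * (a * a) - 1) + (4 * (b * b) - 1) * (4 * (b * b) - 1) in
   all_upto 1 11 (\<lambda>c. let F = E - (4 * (c * c) - 1) * (4 * (c * c) - 1) in if F < 0 then True else
     all_upto 1 11 (\<lambda>d. if F = (4 * (d * d) - 1) * (4 * (d * d) - 1) then a = c \<and> b = d \<or> a = d
       \<and> b = c else True))))"

lemma trip_leads_check: trip_leads_check by code_simp

definition pair_leads_check where "pair_leads_check \<longleftrightarrow>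
  all_upto 1 11 (\<lambda>p. all_upto 1 11 (\<lambda>q. all_upto 8 15 (\<lambda>n. if p * p + q * q = 16 * n then p = 8
    \<and> q = 8 else True)))"

lemma pair_leads_check: pair_leads_check by code_simp

text \<open>Two pairs against two parallelograms. The leading coefficients give \<open>p\<^sup>2 + q\<^sup>2 = 16 (D\<^sup>2 + E\<^sup>2)\<close> with
  \<open>D, E \<ge> 2\<close>, whose only solution with gaps up to 11 is \<open>p = q = 8\<close>, \<open>D = E = 2\<close>. Then the constant
  coefficients equate a sum of two even squares with a sum of two odd squares.\<close>

lemma pairs_sum_parallelograms_sum_differ:
  fixes p q d e d' e' iP iQ i i' :: int
  assumes d: "1 \<le> d" "1 \<le> e" "d \<noteq> e" "1 \<le> d'" "1 \<le> e'" "d' \<noteq> e'" "1 \<le> p" "1 \<le> q"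
    and pq: "p \<le> 11" "q \<le> 11"
    and e0: "p * p + q * q = 16 * ((d * d * e) * (d * d * e)) + 16 * ((d' * d' * e') * (d' * d' *
      e'))"
    and e2: "p * p * ((2 * iP + p) * (2 * iP + p)) + q * q * ((2 * iQ + q) * (2 * iQ + q))
      = 16 * ((d * d * e) * (d * d * e) * ((2 * i + d + e) * (2 * i + d + e)))
      + 16 * ((d' * d' * e') * (d' * d' * e') * ((2 * i' + d' + e') * (2 * i' + d' + e')))"
  shows False
proof -
  define D E where DE: "D = d * d * e" "E = d' * d' * e'"
  have ge2: "2 \<le> D" "2 \<le> E" unfolding DE using parallelogram_area_bounds(1) d by auto
  have sq: "2 * 2 \<le> D * D" "2 * 2 \<le> E * E" using ge2 by (intro mult_mono; simp)+
  have sum: "p * p + q * q = 16 * (D * D + E * E)" using e0 unfolding DE by simp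
  have "p * p \<le> 11 * 11" "q * q \<le> 11 * 11" using d pq by (intro mult_mono; simp)+
  then have "\<not> 16 \<le> D * D + E * E" using sum by (auto simp: distrib_left)
  then have le: "D * D + E * E \<le> 15" by simp
  have "p = 8 \<and> q = 8"
    using pair_leads_check[unfolded pair_leads_check_def, THEN all_uptoD, of p, THEN all_uptoD, of
      q,
      THEN all_uptoD, of "D * D + E * E"] d pq sum sq le by simp
  then have "D * D = 4" "E * E = 4" using sum sq by auto
  moreover have "3 * 3 \<le> D * D" if "3 \<le> D" using that by (intro mult_mono) auto
  moreover have "3 * 3 \<le> E * E" if "3 \<le> E" using that by (intro mult_mono) auto
  ultimately have "D = 2" "E = 2" using ge2 by linarith+
  have two: "d = 1 \<and> e = 2" if "d * d * e = 2" "1 \<le> d" "1 \<le> e" "d \<noteq> e" for d e :: int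
  proof -
    have "d \<le> 2" using parallelogram_area_bounds(2)[of d e] that by auto
    then have "d = 1 \<or> d = 2" using that by auto
    then show ?thesis using that by auto
  qed
  have "d = 1" "e = 2" "d' = 1" "e' = 2"
    using two[of d e] two[of d' e'] d \<open>D = 2\<close> \<open>E = 2\<close> unfolding DE by auto
  then have "(2 * iP + 8) * (2 * iP + 8) + (2 * iQ + 8) * (2 * iQ + 8)
    = (2 * i + 3) * (2 * i + 3) + (2 * i' + 3) * (2 * i' + 3)"
    using e2 \<open>p = 8 \<and> q = 8\<close> by (simp add: algebra_simps)
  then have "4 * ((iP + 4) * (iP + 4) + (iQ + 4) * (iQ + 4))
    = 4 * (i * i + 3 * i + i' * i' + 3 * i') + 18"
    by (simp add: algebra_simps)
  then show False by presburger
qed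

section \<open>Integer obstructions for four triples\<close>

text \<open>The relation \<open>P1\<^sup>2 + P2\<^sup>2 = P3\<^sup>2 + P4\<^sup>2\<close> is studied for triples \<open>P1, P3\<close> whose pairs
  have gap \<open>a\<close> and triples \<open>P2, P4\<close> whose pairs have gap \<open>b\<close>. Let \<open>k\<close> and \<open>d1\<close> be the shifts that
  take the pair and the leaf of \<open>P3\<close> to those of \<open>P1\<close>, and let \<open>k2\<close> and \<open>d2\<close> take those of \<open>P2\<close> to
  those of \<open>P4\<close>. The coefficient of \<open>x\<^sup>3\<close> gives
  \<open>(4a\<^sup>2 - 1)(4a\<^sup>2k - d1) = (4b\<^sup>2 - 1)(4b\<^sup>2k2 - d2)\<close>, a condition on the shifts alone, and the
  coefficient of \<open>x\<^sup>2\<close> is then linear in the positions. The loops therefore run through the shifts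
  first, then through the positions of the pairs, then through those of the leaves; the coefficient
  of \<open>x\<close> rules out the few labellings that survive.\<close>

definition search_second_leaf where "search_second_leaf a b i1 i2 i3 i4 c1 c3 d2 E B' \<longleftrightarrow>
  all_upto (max 0 (-d2)) (11 - max 0 d2) (\<lambda>c2. if E = B' * c2 then
    (if all_distinct [i1, i1 + a, i3, i3 + a, i2, i2 + b, i4, i4 + b, c1, c3, c2, c2 + d2] then
      trip_lin a i1 c1 * trip_cst a i1 c1 + trip_lin b i2 c2 * trip_cst b i2 c2
        \<noteq> trip_lin a i3 c3 * trip_cst a i3 c3 + trip_lin b i4 (c2 + d2) * trip_cst b i4 (c2 + d2)
          else True) else True)"

definition search_first_leaf where "search_first_leaf a b i1 i2 i3 i4 d1 d2 E B B' \<longleftrightarrow>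
    all_upto (max 0 (-d1)) (11 - max 0 d1) (\<lambda>c3. if list_all (\<lambda>y. y \<noteq> c3 \<and> y
      \<noteq> c3 + d1) [i1, i1 + a, i3, i3 + a, i2, i2 + b, i4, i4 + b]
      then search_second_leaf a b i1 i2 i3 i4 (c3 + d1) c3 d2 (E + B * c3) B' else True)"

definition search_disjoint_pairs where "search_disjoint_pairs a b i1 i2 i3 i4 d1 d2 E B B' \<longleftrightarrow>
  (if all_distinct [i1, i1 + a, i3, i3 + a, i2, i2 + b, i4, i4 + b]
    then search_first_leaf a b i1 i2 i3 i4 d1 d2 E B B' else True)"

text \<open>The parameters \<open>A, B, C\<close> and \<open>A', B', C'\<close> stand for the coefficients of \<open>square_coeff_shift\<close> for the
  two kinds of triples. The inner searches receive in \<open>E\<close> the part of the equation for \<open>x\<^sup>2\<close> that is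
  already determined.\<close>

definition search_positions where "search_positions a k b k2 d1 d2 A B C A' B' C' \<longleftrightarrow>
   all_upto 0 (11 - a - k) (\<lambda>i3. all_upto (max 0 (-k2)) (11 - b - max k2 0)
     (\<lambda>i2. search_disjoint_pairs a b (i3 + k) i2 i3 (i2 + k2) d1 d2
      (A * (2 * i3 + a) + C - A' * (2 * i2 + b) - C') B B'))"

definition shift_pair_coeff where "shift_pair_coeff a k d
  = 8 * (a * a) * (k * (12 * (a * a) - 1) - 2 * d)" for a k d :: int

definition shift_leaf_coeff where "shift_leaf_coeff a k d
  = 12 * d - 16 * (a * a) * (2 * k + d)" for a k d :: int

definition shift_const where "shift_const a k d
  = a * a * (24 * (a * a) - 2) * (4 * (k * k)) - 32 * (a * a) * k * d + (6 - 8 * (a * a)) * (d *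
    d)" for a k d :: int

text \<open>If both pairs of triples are related by the same shifts, the coefficient of \<open>x\<^sup>2\<close> says
  \<open>2A (i3 - i2) = B (c2 - c3)\<close>, where \<open>i3 \<noteq> i2\<close> and \<open>\<bar>c2 - c3\<bar> \<le> 11\<close>. This often fails for all positions
  at once.\<close>

definition search_unless_impossible where "search_unless_impossible a k b k2 d1 d2 A B C \<longleftrightarrow>
  (if a = b \<and> k = k2 \<and> d1 = d2 \<and> 2 * \<bar>A\<bar> > 11 * \<bar>B\<bar> then True
    else search_positions a k b k2 d1 d2 A B C (shift_pair_coeff b k2 d2) (shift_leaf_coeff b k2
      d2) (shift_const b k2 d2))"

text \<open>By the coefficient of \<open>x\<^sup>3\<close>, the left side of the first test is \<open>\<bar>l * d1 - l2 * d2\<bar>\<close>, and the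
  shifts \<open>d1\<close> and \<open>d2\<close> of the leaves are at most 11.\<close>

definition search_leaf_gaps where
  "search_leaf_gaps a k l b k2 l2 \<longleftrightarrow> (if \<bar>4 * (a * a) * l * k - 4 * (b * b) * l2 * k2\<bar> \<le> 11 * (l +
    l2) then
   all_upto (-11) 11 (\<lambda>d1. all_upto (-11) 11 (\<lambda>d2. if l * (4 * (a * a) * k - d1)
     = l2 * (4 * (b * b) * k2 - d2) then
     (if d1 \<noteq> 0 then if d2 \<noteq> 0
       then search_unless_impossible a k b k2 d1 d2 (shift_pair_coeff a k d1) (shift_leaf_coeff a
         k d1) (shift_const a k d1) else True else True)
      else True)) else True)"

definition search_other_pair where "search_other_pair a k \<longleftrightarrow> all_upto 1 a (\<lambda>b.
  all_upto (b - 11) (11 - b) (\<lambda>k2. if k2 = 0 then True else if \<bar>k2\<bar> = b then True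
    else search_leaf_gaps a k (4 * (a * a) - 1) b k2 (4 * (b * b) - 1)))"

definition search_shift where "search_shift a \<longleftrightarrow> all_upto 1 (11 - a) (\<lambda>k. if k \<noteq> a
  then search_other_pair a k else True)"

lemma trip_lin_shift: "trip_lin a (i + k) (c + d) - trip_lin a i c = 2 * (4 * (a * a) * k - d)"
  by (simp add: trip_lin_def algebra_simps)

text \<open>The coefficient of \<open>x\<^sup>2\<close> in the difference of the squares of two shifted triples is linear in
  the position of the triple. This is what makes the search cheap.\<close>

lemma square_coeff_shift:
  "2 * (4 * (a * a) - 1) * trip_cst a (i + k) (c + d) + (trip_lin a (i + k) (c + d))\<^sup>2
    - (2 * (4 * (a * a) - 1) * trip_cst a i c + (trip_lin a i c)\<^sup>2)
   = shift_pair_coeff a k d * (2 * i + a) + shift_leaf_coeff a k d * c + shift_const a k d"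
  by (simp add: trip_lin_def trip_cst_def shift_pair_coeff_def shift_leaf_coeff_def
    shift_const_def power2_eq_square algebra_simps)

lemma search_shift_sound:
  fixes a b :: int
  assumes ck: "search_shift a"
    and a: "1 \<le> b" "b \<le> a"
    and i1: "i3 < i1" "i1 + a \<le> 11" and i3: "0 \<le> i3"
    and i2: "0 \<le> i2" "i2 + b \<le> 11" and i4: "0 \<le> i4" "i4 + b \<le> 11"
    and c: "c1 \<in> {0..11}" "c2 \<in> {0..11}" "c3 \<in> {0..11}" "c4 \<in> {0..11}"
    and dst: "distinct [i1, i1 + a, i3, i3 + a, i2, i2 + b, i4, i4 + b, c1, c3, c2, c4]"
    and e3: "(4 * (a * a) - 1) * (trip_lin a i1 c1 - trip_lin a i3 c3)
      = (4 * (b * b) - 1) * (trip_lin b i4 c4 - trip_lin b i2 c2)"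
    and e2: "2 * (4 * (a * a) - 1) * trip_cst a i1 c1 + (trip_lin a i1 c1)\<^sup>2 - (2 * (4 * (a * a) -
      1) * trip_cst a i3 c3 + (trip_lin a i3 c3)\<^sup>2)
           = 2 * (4 * (b * b) - 1) * trip_cst b i4 c4 + (trip_lin b i4 c4)\<^sup>2 - (2 * (4 * (b * b) -
             1) * trip_cst b i2 c2 + (trip_lin b i2 c2)\<^sup>2)"
    and e1: "trip_lin a i1 c1 * trip_cst a i1 c1 + trip_lin b i2 c2 * trip_cst b i2 c2
      = trip_lin a i3 c3 * trip_cst a i3 c3 + trip_lin b i4 c4 * trip_cst b i4 c4"
  shows False
proof -
  define k k2 d1 d2 where "k = i1 - i3" "k2 = i4 - i2" "d1 = c1 - c3" "d2 = c4 - c2"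
  then have eqs: "i1 = i3 + k" "i4 = i2 + k2" "c1 = c3 + d1" "c4 = c2 + d2" by auto
  let ?l = "4 * (a * a) - 1" and ?l2 = "4 * (b * b) - 1"
  have kb: "1 \<le> k" "k \<le> 11 - a" "k \<noteq> a" "b - 11 \<le> k2" "k2 \<le> 11 - b" "k2 \<noteq> 0"
      "k2 \<noteq> b" "k2 \<noteq> - b"
    using i1 i2 i3 i4 dst unfolding eqs by auto
  then have "\<bar>k2\<bar> \<noteq> b" by linarith
  have db: "\<bar>d1\<bar> \<le> 11" "\<bar>d2\<bar> \<le> 11" "d1 \<noteq> 0" "d2 \<noteq> 0"
    using c dst unfolding eqs by auto
  from e3 have e3': "?l * (4 * (a * a) * k - d1) = ?l2 * (4 * (b * b) * k2 - d2)"
    unfolding eqs trip_lin_shift by (simp add: algebra_simps)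
  from e2 have e2': "shift_pair_coeff a k d1 * (2 * i3 + a) + shift_leaf_coeff a k d1 * c3 +
    shift_const a k d1
      = shift_pair_coeff b k2 d2 * (2 * i2 + b) + shift_leaf_coeff b k2 d2 * c2 + shift_const b k2
        d2"
    unfolding eqs square_coeff_shift by simp
  have pos: "0 \<le> ?l" "0 \<le> ?l2" using a mult_mono[of 1 a 1 a] mult_mono[of 1 b 1 b] by auto
  have "\<bar>4 * (a * a) * ?l * k - 4 * (b * b) * ?l2 * k2\<bar> = \<bar>?l * d1 - ?l2 * d2\<bar>"
    using e3' by (simp add: algebra_simps)
  also have "\<dots> \<le> \<bar>?l * d1\<bar> + \<bar>?l2 * d2\<bar>" by (rule abs_triangle_ineq4)
  also have "\<dots> \<le> ?l * 11 + ?l2 * 11"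
    using pos db by (intro add_mono) (simp_all only: abs_mult abs_of_nonneg mult_left_mono)
  finally have bound: "\<bar>4 * (a * a) * ?l * k - 4 * (b * b) * ?l2 * k2\<bar> \<le> 11 * (?l + ?l2)" by simp
  have no_prune: "\<not> (a = b \<and> k = k2 \<and> d1 = d2
    \<and> 2 * \<bar>shift_pair_coeff a k d1\<bar> > 11 * \<bar>shift_leaf_coeff a k d1\<bar>)"
  proof
    assume *: "a = b \<and> k = k2 \<and> d1 = d2
      \<and> 2 * \<bar>shift_pair_coeff a k d1\<bar> > 11 * \<bar>shift_leaf_coeff a k d1\<bar>"
    have "shift_pair_coeff a k d1 * (2 * (i3 - i2)) = shift_leaf_coeff a k d1 * (c2 - c3)"
      using e2' * by (simp add: algebra_simps)
    then have "\<bar>shift_pair_coeff a k d1\<bar> * \<bar>2 * (i3 - i2)\<bar> = \<bar>shift_leaf_coeff a k d1\<bar> * \<bar>c2 - c3\<bar>"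
      by (metis abs_mult)
    moreover have "\<bar>shift_leaf_coeff a k d1\<bar> * \<bar>c2 - c3\<bar> \<le> \<bar>shift_leaf_coeff a k d1\<bar> * 11"
      using c by (intro mult_left_mono) auto
    moreover have "i3 \<noteq> i2" using dst by auto
    then have "2 \<le> \<bar>2 * (i3 - i2)\<bar>" by presburger
    then have "\<bar>shift_pair_coeff a k d1\<bar> * 2 \<le> \<bar>shift_pair_coeff a k d1\<bar> * \<bar>2 * (i3 - i2)\<bar>"
      by (intro mult_left_mono) auto
    ultimately show False using * by linarith
  qed
  have "search_other_pair a k" using ck kb unfolding search_shift_def all_upto_iff by auto
  then have "search_leaf_gaps a k ?l b k2 ?l2" using a kb \<open>\<bar>k2\<bar> \<noteq> b\<close>
    unfolding search_other_pair_def all_upto_iff by auto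
  then have "all_upto (-11) 11 (\<lambda>d1. all_upto (-11) 11 (\<lambda>d2. if ?l * (4 * (a * a) * k - d1)
    = ?l2 * (4 * (b * b) * k2 - d2) then
     (if d1 \<noteq> 0 then if d2 \<noteq> 0
       then search_unless_impossible a k b k2 d1 d2 (shift_pair_coeff a k d1) (shift_leaf_coeff a
         k d1) (shift_const a k d1) else True else True)
      else True))" unfolding search_leaf_gaps_def using bound by (simp only: if_True)
  from all_uptoD[OF all_uptoD[OF this, of d1], of d2]
  have "search_unless_impossible a k b k2 d1 d2 (shift_pair_coeff a k d1) (shift_leaf_coeff a k
    d1) (shift_const a k d1)"
    using db e3' by (simp only: if_True abs_le_iff) auto
  then have "search_positions a k b k2 d1 d2 (shift_pair_coeff a k d1) (shift_leaf_coeff a k d1)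
    (shift_const a k d1) (shift_pair_coeff b k2 d2) (shift_leaf_coeff b k2 d2) (shift_const b k2
      d2)"
    using no_prune unfolding search_unless_impossible_def by metis
  then have "search_disjoint_pairs a b (i3 + k) i2 i3 (i2 + k2) d1 d2
      (shift_pair_coeff a k d1 * (2 * i3 + a) + shift_const a k d1 - shift_pair_coeff b k2 d2 * (2
        * i2 + b) - shift_const b k2 d2) (shift_leaf_coeff a k d1) (shift_leaf_coeff b k2 d2)"
    (is "search_disjoint_pairs _ _ _ _ _ _ _ _ ?E _ _")
    using i1 i2 i3 i4 unfolding search_positions_def all_upto_iff eqs by simp
  then have "search_first_leaf a b (i3 + k) i2 i3 (i2 + k2) d1 d2 ?E (shift_leaf_coeff a k d1)
    (shift_leaf_coeff b k2 d2)"
    using dst unfolding search_disjoint_pairs_def all_distinct_iff eqs by simp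
  then have "if list_all (\<lambda>y. y \<noteq> c3 \<and> y \<noteq> c3 + d1)
        [i3 + k, i3 + k + a, i3, i3 + a, i2, i2 + b, i2 + k2, i2 + k2 + b]
      then search_second_leaf a b (i3 + k) i2 i3 (i2 + k2) (c3 + d1) c3 d2 (?E + shift_leaf_coeff
        a k d1 * c3) (shift_leaf_coeff b k2 d2) else True"
    unfolding search_first_leaf_def by (rule all_uptoD) (use c eqs in auto)
  moreover have "list_all (\<lambda>y. y \<noteq> c3 \<and> y \<noteq> c3 + d1)
        [i3 + k, i3 + k + a, i3, i3 + a, i2, i2 + b, i2 + k2, i2 + k2 + b]"
    using dst unfolding eqs by (simp only: list.pred_inject distinct.simps list.set insert_iff
      de_Morgan_disj) blast
  ultimately have "search_second_leaf a b (i3 + k) i2 i3 (i2 + k2) (c3 + d1) c3 d2 (?E +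
    shift_leaf_coeff a k d1 * c3) (shift_leaf_coeff b k2 d2)"
    by (simp only: if_True)
  then have "if ?E + shift_leaf_coeff a k d1 * c3 = shift_leaf_coeff b k2 d2 * c2 then
    (if all_distinct [i3 + k, i3 + k + a, i3, i3 + a, i2, i2 + b, i2 + k2, i2 + k2 + b, c3 + d1,
      c3, c2, c2 + d2] then
      trip_lin a (i3 + k) (c3 + d1) * trip_cst a (i3 + k) (c3 + d1) + trip_lin b i2 c2 * trip_cst
        b i2 c2
       \<noteq> trip_lin a i3 c3 * trip_cst a i3 c3 + trip_lin b (i2 + k2) (c2 + d2) * trip_cst b (i2 +
         k2) (c2 + d2) else True) else True"
    unfolding search_second_leaf_def by (rule all_uptoD) (use c eqs in auto)
  moreover have "?E + shift_leaf_coeff a k d1 * c3 = shift_leaf_coeff b k2 d2 * c2" using e2'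
    by linarith
  ultimately show False
    using dst e1 unfolding all_distinct_iff eqs by (simp only: if_True refl not_True_eq_False)
qed

lemma search_shift_1: "search_shift 1" by code_simp

lemma search_shift_2: "search_shift 2" by code_simp

lemma search_shift_3_to_10: "search_shift 3" "search_shift 4" "search_shift 5" "search_shift 6"
  "search_shift 7" "search_shift 8" "search_shift 9" "search_shift 10" by code_simp+

lemma search_shift: "a \<in> {1..10} \<Longrightarrow> search_shift a"
proof -
  assume "a \<in> {1..10}"
  then have "a \<in> {1, 2, 3, 4, 5, 6, 7, 8, 9, 10}" by (simp, presburger)
  then show ?thesis using search_shift_1 search_shift_2 search_shift_3_to_10 by auto
qed

text \<open>Exchanging the two sides and exchanging the two triples on each side allows to assume
  \<open>b \<le> a\<close> and \<open>i3 < i1\<close>, as in the search.\<close>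

lemma four_trips_differ:
  fixes a b :: int
  assumes a: "1 \<le> a" "1 \<le> b"
    and r: "0 \<le> i1" "i1 + a \<le> 11" "0 \<le> i2" "i2 + b \<le> 11" "0 \<le> i3" "i3 + a \<le> 11" "0 \<le> i4"
      "i4 + b \<le> 11"
    and c: "c1 \<in> {0..11}" "c2 \<in> {0..11}" "c3 \<in> {0..11}" "c4 \<in> {0..11}"
    and dst: "distinct [i1, i1 + a, c1, i2, i2 + b, c2, i3, i3 + a, c3, i4, i4 + b, c4]"
    and e3: "(4 * (a * a) - 1) * trip_lin a i1 c1 + (4 * (b * b) - 1) * trip_lin b i2 c2
      = (4 * (a * a) - 1) * trip_lin a i3 c3 + (4 * (b * b) - 1) * trip_lin b i4 c4"
    and e2: "2 * ((4 * (a * a) - 1) * trip_cst a i1 c1) + trip_lin a i1 c1 * trip_lin a i1 c1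
      + (2 * ((4 * (b * b) - 1) * trip_cst b i2 c2) + trip_lin b i2 c2 * trip_lin b i2 c2)
      = 2 * ((4 * (a * a) - 1) * trip_cst a i3 c3) + trip_lin a i3 c3 * trip_lin a i3 c3
      + (2 * ((4 * (b * b) - 1) * trip_cst b i4 c4) + trip_lin b i4 c4 * trip_lin b i4 c4)"
    and e1: "trip_lin a i1 c1 * trip_cst a i1 c1 + trip_lin b i2 c2 * trip_cst b i2 c2
      = trip_lin a i3 c3 * trip_cst a i3 c3 + trip_lin b i4 c4 * trip_cst b i4 c4"
  shows False
proof -
  have main: False
    if "b \<le> a" "i3 < i1" "1 \<le> b" 
      and r: "0 \<le> i1" "i1 + a \<le> 11" "0 \<le> i2" "i2 + b \<le> 11" "0 \<le> i3" "i3 + a \<le> 11" "0 \<le> i4"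
        "i4 + b \<le> 11"
      and c: "c1 \<in> {0..11}" "c2 \<in> {0..11}" "c3 \<in> {0..11}" "c4 \<in> {0..11}"
      and dst: "distinct [i1, i1 + a, c1, i2, i2 + b, c2, i3, i3 + a, c3, i4, i4 + b, c4]"
      and e3: "(4 * (a * a) - 1) * trip_lin a i1 c1 + (4 * (b * b) - 1) * trip_lin b i2 c2
        = (4 * (a * a) - 1) * trip_lin a i3 c3 + (4 * (b * b) - 1) * trip_lin b i4 c4"
      and e2: "2 * ((4 * (a * a) - 1) * trip_cst a i1 c1) + trip_lin a i1 c1 * trip_lin a i1 c1
        + (2 * ((4 * (b * b) - 1) * trip_cst b i2 c2) + trip_lin b i2 c2 * trip_lin b i2 c2)
        = 2 * ((4 * (a * a) - 1) * trip_cst a i3 c3) + trip_lin a i3 c3 * trip_lin a i3 c3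
        + (2 * ((4 * (b * b) - 1) * trip_cst b i4 c4) + trip_lin b i4 c4 * trip_lin b i4 c4)"
      and e1: "trip_lin a i1 c1 * trip_cst a i1 c1 + trip_lin b i2 c2 * trip_cst b i2 c2
        = trip_lin a i3 c3 * trip_cst a i3 c3 + trip_lin b i4 c4 * trip_cst b i4 c4"
    for a b i1 i2 i3 i4 c1 c2 c3 c4 :: int
  proof -
    have "a \<in> {1..10}" using that by auto
    from search_shift[OF this] show False
    proof (rule search_shift_sound)
      show "distinct [i1, i1 + a, i3, i3 + a, i2, i2 + b, i4, i4 + b, c1, c3, c2, c4]"
        using dst by (rule mset_eq_imp_distinct_iff[THEN iffD1, rotated]) simp
      show "(4 * (a * a) - 1) * (trip_lin a i1 c1 - trip_lin a i3 c3)
        = (4 * (b * b) - 1) * (trip_lin b i4 c4 - trip_lin b i2 c2)"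
        using e3 by (simp add: right_diff_distrib)
      show "2 * (4 * (a * a) - 1) * trip_cst a i1 c1 + (trip_lin a i1 c1)\<^sup>2 - (2 * (4 * (a * a) -
        1) * trip_cst a i3 c3 + (trip_lin a i3 c3)\<^sup>2)
           = 2 * (4 * (b * b) - 1) * trip_cst b i4 c4 + (trip_lin b i4 c4)\<^sup>2 - (2 * (4 * (b * b) -
             1) * trip_cst b i2 c2 + (trip_lin b i2 c2)\<^sup>2)"
        using e2 unfolding power2_eq_square mult.assoc by linarith
    qed (fact that | fact)+
  qed
  have ne: "i1 \<noteq> i3" "i2 \<noteq> i4" using dst by auto
  have perm: "distinct [i2, i2 + b, c2, i1, i1 + a, c1, i4, i4 + b, c4, i3, i3 + a, c3]"
    "distinct [i3, i3 + a, c3, i4, i4 + b, c4, i1, i1 + a, c1, i2, i2 + b, c2]"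
    "distinct [i4, i4 + b, c4, i3, i3 + a, c3, i2, i2 + b, c2, i1, i1 + a, c1]"
    using dst by (rule mset_eq_imp_distinct_iff[THEN iffD1, rotated], simp)+
  consider "b \<le> a" "i3 < i1" | "b \<le> a" "i1 < i3" | "a \<le> b" "i4 < i2" | "a \<le> b" "i2 < i4"
    using ne by linarith
  then show False
  proof cases
    case 1
    show False by (rule main[OF 1 a(2) r c dst e3 e2 e1])
  next
    case 2
    show False
      by (rule main[OF 2 a(2) r(5-8) r(1-4) c(3,4,1,2) perm(2) e3[symmetric] e2[symmetric]
        e1[symmetric]])
  next
    case 3
    show False
      by (rule main[OF 3 a(1) r(3,4,1,2,7,8,5,6) c(2,1,4,3) perm(1)]) (use e3 e2 e1 in linarith)+
  next
    case 4
    show False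
      by (rule main[OF 4 a(1) r(7,8,5,6,3,4,1,2) c(4,3,2,1) perm(3)]) (use e3 e2 e1 in linarith)+
  qed
qed

section \<open>Relations between four trees with at least two leaves each\<close>

text \<open>The tree \<open>D\<close> is constant or linear. In the second case 32 divides its leading coefficient \<open>a\<close>,
  but \<open>a\<^sup>2 = 4 (p\<^sup>2 + q\<^sup>2 - r\<^sup>2) < 32\<^sup>2\<close>. In the first case \<open>D\<close> would be zero.\<close>

lemma no_relation_2226:
  assumes fam: "disjoint_labels [A, B, C, D]" and eq: "(pol A)\<^sup>2 + (pol B)\<^sup>2
    = (pol C)\<^sup>2 + (pol D)\<^sup>2"
    and len: "length (labs A) = 2" "length (labs B) = 2" "length (labs C) = 2" "length (labs D) = 6"
  shows False
proof -
  have admissible: "admissible A" "admissible B" "admissible C" "admissible D"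
    using disjoint_labels_admissible[OF fam] by auto
  obtain i p where A: "0 \<le> i" "1 \<le> p" "i + p \<le> 11" "(pol A)\<^sup>2 = (pair_poly i p)\<^sup>2"
    using pair_shape[OF admissible(1) len(1)] by metis
  obtain j q where B: "0 \<le> j" "1 \<le> q" "j + q \<le> 11" "(pol B)\<^sup>2 = (pair_poly j q)\<^sup>2"
    using pair_shape[OF admissible(2) len(2)] by metis
  obtain k r where C: "0 \<le> k" "1 \<le> r" "k + r \<le> 11" "(pol C)\<^sup>2 = (pair_poly k r)\<^sup>2"
    using pair_shape[OF admissible(3) len(3)] by metis
  have "(pol D)\<^sup>2 = (pair_poly i p)\<^sup>2 + (pair_poly j q)\<^sup>2 - (pair_poly k r)\<^sup>2"
    using eq unfolding A(4) B(4) C(4) by (simp add: algebra_simps)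
  then have D: "(pol D)\<^sup>2
    = [:p * p * ((2 * i + p) * (2 * i + p)) + q * q * ((2 * j + q) * (2 * j + q)) - r * r * ((2 *
      k + r) * (2 * k + r)),
      4 * (p * p * (2 * i + p)) + 4 * (q * q * (2 * j + q)) - 4 * (r * r * (2 * k + r)),
      4 * (p * p) + 4 * (q * q) - 4 * (r * r):]" by (simp add: pair_poly_square)
  from degree_le_1_square[OF this] have dD: "degree (pol D) \<le> 1" .
  define a b where ab: "a = coeff (pol D) 1" "b = coeff (pol D) 0"
  have pD: "pol D = [:b, a:]" unfolding ab by (rule linear_poly_eq[OF dD])
  show False
  proof (cases "a = 0")
    case True
    then have "degree (pol D) = 0" using pD by simp
    then show False using constant_pol_eq_0 pol_nonzero_6[OF admissible(4) len(4)] by blast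
  next
    case False
    have "32 dvd a" using linear_tree_divisibility[OF pD False] len(4) by simp
    then obtain c where c: "a = 32 * c" by blast
    have "\<bar>c\<bar> \<ge> 1" using False c by simp
    then have "1 * 1 \<le> \<bar>c\<bar> * \<bar>c\<bar>" by (intro mult_mono) auto
    then have "1 \<le> c * c" by (simp flip: abs_mult)
    moreover have "a * a = 4 * (p * p) + 4 * (q * q) - 4 * (r * r)"
      using D unfolding pD by (simp add: square_linear)
    moreover have "p * p \<le> 11 * 11" "q * q \<le> 11 * 11" using A B by (intro mult_mono; simp)+
    moreover have "0 \<le> r * r" by simp
    ultimately show False unfolding c by simp
  qed
qed

text \<open>The left side has degree 2, but the square of a triple has degree 4.\<close>

lemma no_relation_2235:
  assumes fam: "disjoint_labels [A, B, C, D]" and eq: "(pol A)\<^sup>2 + (pol B)\<^sup>2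
    = (pol C)\<^sup>2 + (pol D)\<^sup>2"
    and len: "length (labs A) = 2" "length (labs B) = 2" "length (labs C) = 3"
  shows False
proof -
  have admissible: "admissible A" "admissible B" "admissible C"
    using disjoint_labels_admissible[OF fam] by auto
  obtain i p where A: "(pol A)\<^sup>2 = (pair_poly i p)\<^sup>2"
    using pair_shape[OF admissible(1) len(1)] by metis
  obtain j q where B: "(pol B)\<^sup>2 = (pair_poly j q)\<^sup>2"
    using pair_shape[OF admissible(2) len(2)] by metis
  obtain k a c where C: "1 \<le> a" "(pol C)\<^sup>2 = [:trip_cst a k c, trip_lin a k c, 4 * (a * a) - 1:]\<^sup>2"
    using trip_shape[OF admissible(3) len(3)] by metis
  have "degree ((pol C)\<^sup>2 + (pol D)\<^sup>2) \<le> 2 * 1"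
    unfolding eq[symmetric] A B pair_poly_square by simp
  then have "degree (pol C) \<le> 1" by (rule degree_sum_squares)
  then have "coeff ((pol C)\<^sup>2) 4 = 0"
    by (intro coeff_eq_0 le_less_trans[OF degree_power_le]) simp
  moreover have "coeff ((pol C)\<^sup>2) 4 = (4 * (a * a) - 1) * (4 * (a * a) - 1)"
    unfolding C(2) square_quadratic by (simp add: numeral_eq_Suc)
  ultimately show False using trip_lead_pos[OF C(1)] by simp
qed

text \<open>By degrees, the five leaves of \<open>D\<close> split into a leaf \<open>c'\<close> and a linear tree \<open>zx + w\<close>. The leading
  coefficients give \<open>z = \<plusminus>2a\<close>, and then the coefficient of \<open>x\<^sup>3\<close> gives \<open>c - c' = 2a\<^sup>2 (2i + a) - zw\<close>. By
  \<open>linear_tree_divisibility\<close>, 8 divides \<open>z\<close> and \<open>w\<close> is even, so 16 divides \<open>c - c'\<close>.\<close>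

lemma no_relation_3225:
  assumes fam: "disjoint_labels [A, B, C, D]" and eq: "(pol A)\<^sup>2 + (pol B)\<^sup>2
    = (pol C)\<^sup>2 + (pol D)\<^sup>2"
    and len: "length (labs A) = 3" "length (labs B) = 2" "length (labs C) = 2" "length (labs D) = 5"
  shows False
proof -
  have admissible: "admissible A" "admissible B" "admissible C" "admissible D"
    using disjoint_labels_admissible[OF fam] by auto
  obtain i a c where A: "1 \<le> a" "i + a \<le> 11" "0 \<le> i" "0 \<le> c" "c \<le> 11" "set (labs A)
    = set [i, i + a, c]"
    "(pol A)\<^sup>2 = [:trip_cst a i c, trip_lin a i c, 4 * (a * a) - 1:]\<^sup>2"
    using trip_shape[OF admissible(1) len(1)] by metis
  obtain j p where B: "(pol B)\<^sup>2 = (pair_poly j p)\<^sup>2"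
    using pair_shape[OF admissible(2) len(2)] by metis
  obtain k q where C: "(pol C)\<^sup>2 = (pair_poly k q)\<^sup>2"
    using pair_shape[OF admissible(3) len(3)] by metis
  have "degree ((pol C)\<^sup>2 + (pol D)\<^sup>2) \<le> 2 * 2"
    unfolding eq[symmetric] A(7) B pair_poly_square square_quadratic by simp
  then have dD: "degree (pol D) \<le> 2" by (rule degree_sum_squares)
  obtain l r where lr: "admissible l" "admissible r" "set (labs D) = set (labs l) \<union> set (labs r)"
    "(pol D)\<^sup>2 = ((pol l)\<^sup>2 - (pol r)\<^sup>2)\<^sup>2"
    "pol D = (pol l)\<^sup>2 - (pol r)\<^sup>2 \<or> pol D = (pol r)\<^sup>2 - (pol l)\<^sup>2"
    "length (labs l) + length (labs r) = 5" "1 \<le> length (labs l)"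
      "length (labs l) \<le> length (labs r)"
    by (rule tree_split_le[OF admissible(4) len(4)]) auto
  have D4: "coeff ((pol l)\<^sup>2) 4 = coeff ((pol r)\<^sup>2) 4"
  proof -
    have "coeff (pol D) 4 = 0" using dD by (intro coeff_eq_0) simp
    then show ?thesis using lr(5) by auto
  qed
  consider "length (labs l) = 1" "length (labs r) = 4" | "length (labs l) = 2" "length (labs r) = 3"
    using lr(6-8) by linarith
  then show False
  proof cases
    case 2
    obtain k' q' where l: "(pol l)\<^sup>2 = (pair_poly k' q')\<^sup>2"
      using pair_shape[OF lr(1) 2(1)] by metis
    obtain k a c where r: "1 \<le> a" "(pol r)\<^sup>2
      = [:trip_cst a k c, trip_lin a k c, 4 * (a * a) - 1:]\<^sup>2"
      using trip_shape[OF lr(2) 2(2)] by metis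
    have "(4 * (a * a) - 1) * (4 * (a * a) - 1) = 0"
      using D4 unfolding l r(2) square_quadratic pair_poly_square by (simp add: numeral_eq_Suc)
    then show False using trip_lead_pos[OF r(1)] by simp
  next
    case 1
    obtain c' where l: "l = Leaf c'" "0 \<le> c'" "c' \<le> 11" using leaf_shape[OF lr(1) 1(1)] by auto
    have "(pol l)\<^sup>2 \<noteq> (pol r)\<^sup>2" using leaf_iff_of_squares_eq[of l r] 1 by auto
    moreover have "degree ((pol l)\<^sup>2 - (pol r)\<^sup>2) \<le> 2" using lr(5) dD
      by (metis degree_minus minus_diff_eq)
    ultimately have dr: "degree (pol r) \<le> 2" by (rule degree_diff_squares)
    have "coeff ((pol r)\<^sup>2) (2 * 2) = 0" using D4 unfolding l
      by (simp add: square_linear numeral_eq_Suc)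
    then have "coeff (pol r) 2 = 0" by (simp only: coeff_square_top[OF dr]) simp
    then have "degree (pol r) \<le> 1" using dr
      by (metis One_nat_def Suc_1 le_SucE leading_coeff_0_iff degree_0 le0)
    then obtain w z where r: "pol r = [:w, z:]" using linear_poly_eq by blast
    have "[:c', 1:]\<^sup>2 - [:w, z:]\<^sup>2 = [:c' * c' - w * w, 2 * c' - 2 * (z * w), 1 - z * z:]"
      by (simp add: square_linear)
    then have "(pol D)\<^sup>2 = [:c' * c' - w * w, 2 * c' - 2 * (z * w), 1 - z * z:]\<^sup>2"
      using lr(4) unfolding r l by simp
    with eq have co: "(4 * (a * a) - 1) * (4 * (a * a) - 1) = (1 - z * z) * (1 - z * z)"
      "2 * ((4 * (a * a) - 1) * trip_lin a i c) = 2 * ((1 - z * z) * (2 * c' - 2 * (z * w)))"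
      unfolding A(7) B C by (simp_all add: pair_poly_square square_quadratic)
    \<comment> \<open>A difference of two squares whose first factor is positive.\<close>
    have "(4 * (a * a) - 1 - (1 - z * z)) * (4 * (a * a) - 1 + (1 - z * z)) = 0"
      using co(1) by (simp add: algebra_simps)
    moreover have "4 * (a * a) - 1 - (1 - z * z) \<noteq> 0"
      using trip_lead_pos[OF A(1)] zero_le_square[of z] by linarith
    ultimately have zz: "z * z = 4 * (a * a)" by simp
    then have "(1 - z * z) * (2 * c' - 2 * (z * w)) = (4 * (a * a) - 1) * (2 * (z * w) - 2 * c')"
      by (simp add: algebra_simps)
    then have "(4 * (a * a) - 1) * trip_lin a i c = (4 * (a * a) - 1) * (2 * (z * w) - 2 * c')"
      using co(2) by simp
    then have "trip_lin a i c = 2 * (z * w) - 2 * c'" using trip_lead_pos[OF A(1)] by simp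
    then have cc: "c - c' = 2 * (a * a) * (2 * i + a) - z * w" by (simp add: trip_lin_def)
    have "z \<noteq> 0" using zz A(1) by auto
    have *: "8 dvd z" "even (w - z div 2)" using linear_tree_divisibility[OF r \<open>z \<noteq> 0\<close>] 1(2) by auto
    from *(1) obtain f where f: "z = 8 * f" by blast
    then have "even w" using *(2) by simp
    then obtain v where v: "w = 2 * v" by blast
    have "a * a = 16 * (f * f)" using zz f by simp
    then have "c - c' = 16 * (2 * (f * f) * (2 * i + a) - f * v)" using cc f v by simp
    then have "16 dvd c - c'" by simp
    moreover have "c \<noteq> c'" using fam A(6) lr(3) l(1) by (auto simp: disjoint_labels_def)
    moreover have "\<bar>c - c'\<bar> \<le> 11" using A l by auto
    ultimately show False by presburger
  qed
qed

text \<open>By degrees, both quadruples are parallelograms.\<close>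

lemma no_relation_2244:
  assumes fam: "disjoint_labels [A, B, C, D]" and eq: "(pol A)\<^sup>2 + (pol B)\<^sup>2
    = (pol C)\<^sup>2 + (pol D)\<^sup>2"
    and len: "length (labs A) = 2" "length (labs B) = 2" "length (labs C) = 4" "length (labs D) = 4"
  shows False
proof -
  have admissible: "admissible A" "admissible B" "admissible C" "admissible D"
    using disjoint_labels_admissible[OF fam] by auto
  obtain i p where A: "0 \<le> i" "1 \<le> p" "i + p \<le> 11" "(pol A)\<^sup>2 = (pair_poly i p)\<^sup>2"
    using pair_shape[OF admissible(1) len(1)] by metis
  obtain j q where B: "0 \<le> j" "1 \<le> q" "j + q \<le> 11" "(pol B)\<^sup>2 = (pair_poly j q)\<^sup>2"
    using pair_shape[OF admissible(2) len(2)] by metis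
  have "degree ((pol C)\<^sup>2 + (pol D)\<^sup>2) \<le> 2 * 1"
    unfolding eq[symmetric] A(4) B(4) pair_poly_square by simp
  then have "degree (pol C) \<le> 1" "degree (pol D) \<le> 1" by (rule degree_sum_squares)+
  then obtain k d e l d' e' where
    C: "1 \<le> d" "1 \<le> e" "d \<noteq> e" "(pol C)\<^sup>2
      = [:4 * (d * d * e) * (2 * k + d + e), 8 * (d * d * e):]\<^sup>2" and
    D: "1 \<le> d'" "1 \<le> e'" "d' \<noteq> e'" "(pol D)\<^sup>2
      = [:4 * (d' * d' * e') * (2 * l + d' + e'), 8 * (d' * d' * e'):]\<^sup>2"
    using parallelogram_shape[OF admissible(3) len(3)] parallelogram_shape[OF admissible(4)
      len(4)] by metis
  have "p * p + q * q = 16 * ((d * d * e) * (d * d * e)) + 16 * ((d' * d' * e') * (d' * d' * e'))"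
    "p * p * ((2 * i + p) * (2 * i + p)) + q * q * ((2 * j + q) * (2 * j + q))
      = 16 * ((d * d * e) * (d * d * e) * ((2 * k + d + e) * (2 * k + d + e)))
      + 16 * ((d' * d' * e') * (d' * d' * e') * ((2 * l + d' + e') * (2 * l + d' + e')))"
    using eq unfolding A(4) B(4) C(4) D(4) pair_poly_square parallelogram_square by simp_all
  from pairs_sum_parallelograms_sum_differ[OF C(1-3) D(1-3) A(2) B(2) _ _ this] A B show False
    by simp
qed

text \<open>The squares of the two quadruples differ by at most a quadratic polynomial, so the quadruples have
  the same leading coefficient up to sign. If it is zero, both are parallelograms. Otherwise
  they agree except in the constant coefficient.\<close>

lemma no_relation_4224:
  assumes fam: "disjoint_labels [A, B, C, D]" and eq: "(pol A)\<^sup>2 + (pol B)\<^sup>2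
    = (pol C)\<^sup>2 + (pol D)\<^sup>2"
    and len: "length (labs A) = 4" "length (labs B) = 2" "length (labs C) = 2" "length (labs D) = 4"
  shows False
proof -
  have admissible: "admissible A" "admissible B" "admissible C" "admissible D"
    using disjoint_labels_admissible[OF fam] by auto
  obtain iP p where B: "0 \<le> iP" "1 \<le> p" "iP + p \<le> 11" "set (labs B) = set [iP, iP + p]" "(pol B)\<^sup>2
    = (pair_poly iP p)\<^sup>2"
    using pair_shape[OF admissible(2) len(2)] by metis
  obtain iQ q where C: "0 \<le> iQ" "1 \<le> q" "iQ + q \<le> 11" "set (labs C) = set [iQ, iQ + q]" "(pol C)\<^sup>2
    = (pair_poly iQ q)\<^sup>2"
    using pair_shape[OF admissible(3) len(3)] by metis
  have dBC: "distinct [iP, iP + p]" "distinct [iQ, iQ + q]" using B C by auto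
  have ne: "(pol A)\<^sup>2 \<noteq> (pol D)\<^sup>2"
  proof
    assume "(pol A)\<^sup>2 = (pol D)\<^sup>2"
    then have "(pair_poly iP p)\<^sup>2 = (pair_poly iQ q)\<^sup>2" using eq B(5) C(5) by simp
    then have "iP = iQ" using pair_injective B C by blast
    then show False using fam B C by (auto simp: disjoint_labels_def)
  qed
  have diff: "(pol A)\<^sup>2 - (pol D)\<^sup>2 = (pair_poly iQ q)\<^sup>2 - (pair_poly iP p)\<^sup>2"
    using eq B(5) C(5) by (simp add: algebra_simps)
  have "degree ((pol A)\<^sup>2 - (pol D)\<^sup>2) \<le> 2"
    unfolding diff by (simp add: pair_poly_square)
  from degree_diff_squares[OF ne this] have deg: "degree (pol A) \<le> 3" "degree (pol D) \<le> 3"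
    by simp_all
  obtain i d j e where A: "0 \<le> i" "1 \<le> d" "i + d \<le> 11" "0 \<le> j" "1 \<le> e" "j + e \<le> 11" "e \<le> d"
    "distinct [i, i + d, j, j + e]" "set (labs A) = set [i, i + d, j, j + e]"
    "(pol A)\<^sup>2 = [:quad_cst d i e j, 4 * quad_lin d i e j, 4 * (d * d - e * e):]\<^sup>2"
    by (rule ordered_quad_shape[OF admissible(1) len(1) deg(1)])
  obtain i' d' j' e' where D: "0 \<le> i'" "1 \<le> d'" "i' + d' \<le> 11" "0 \<le> j'" "1 \<le> e'" "j' + e' \<le> 11"
    "e' \<le> d'"
    "distinct [i', i' + d', j', j' + e']" "set (labs D) = set [i', i' + d', j', j' + e']"
    "(pol D)\<^sup>2 = [:quad_cst d' i' e' j', 4 * quad_lin d' i' e' j', 4 * (d' * d' - e' * e'):]\<^sup>2"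
    by (rule ordered_quad_shape[OF admissible(4) len(4) deg(2)])
  define x where "x = d * d - e * e"
  define x' where "x' = d' * d' - e' * e'"
  have co: "x * x = x' * x'" "x * quad_lin d i e j = x' * quad_lin d' i' e' j'"
    "2 * (quad_cst d i e j * (4 * x)) + 4 * quad_lin d i e j * (4 * quad_lin d i e j) + 4 * (p * p)
     = 2 * (quad_cst d' i' e' j' * (4 * x')) + 4 * quad_lin d' i' e' j' * (4 * quad_lin d' i' e'
       j') + 4 * (q * q)"
    using eq unfolding A(10) D(10) B(5) C(5) x_def[symmetric] x'_def[symmetric] square_quadratic
      pair_poly_square
    by simp_all
  have x0: "0 \<le> x" "0 \<le> x'" using A(2,5,7) D(2,5,7) unfolding x_def x'_def
    by (simp_all add: mult_mono)
  then have xx: "x' = x" using co(1) by (simp flip: power2_eq_square)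
  show False
  proof (cases "x = 0")
    case True
    have "degree (pol A) \<le> 1" "degree (pol D) \<le> 1"
      using degree_le_1_of_square_quadratic[OF A(10)] degree_le_1_of_square_quadratic[OF D(10)]
        True xx unfolding x_def x'_def by simp_all
    then obtain k a b l a' b' where
      A': "0 \<le> k" "1 \<le> a" "1 \<le> b" "a \<noteq> b" "k + a + b \<le> 11" "distinct [k, k + a, k + b, k + a + b]"
        "set (labs A) = set [k, k + a, k + b, k + a + b]"
        "(pol A)\<^sup>2 = [:4 * (a * a * b) * (2 * k + a + b), 8 * (a * a * b):]\<^sup>2" and
      D': "0 \<le> l" "1 \<le> a'" "1 \<le> b'" "a' \<noteq> b'" "l + a' + b' \<le> 11"
        "distinct [l, l + a', l + b', l + a' + b']"
        "set (labs D) = set [l, l + a', l + b', l + a' + b']"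
        "(pol D)\<^sup>2 = [:4 * (a' * a' * b') * (2 * l + a' + b'), 8 * (a' * a' * b'):]\<^sup>2"
      using parallelogram_shape[OF admissible(1) len(1)] parallelogram_shape[OF admissible(4)
        len(4)] by metis
    have "disjoint_labels [B, C, A, D]" using fam by (auto simp: disjoint_labels_def)
    from disjoint_labels_distinct[OF this dBC(1) B(4) dBC(2) C(4) A'(6,7) D'(6,7)]
    have dst: "distinct [iP, iP + p, iQ, iQ + q, k, k + a, k + b, k + a + b, l, l + a', l + b', l
      + a' + b']" by simp
    show False
      using eq unfolding A'(8) D'(8) B(5) C(5) parallelogram_square pair_poly_square
      by (intro pairs_and_parallelograms_differ[OF A'(2-4) D'(2-4) B(2) C(2) A'(1,5) D'(1,5)
        B(1,3) C(1,3) dst]) simp_all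
  next
    case False
    then have "x > 0" using x0 by simp
    have lt: "e < d" "e' < d'"
      using \<open>x > 0\<close> xx A(7) D(7) unfolding x_def x'_def by (auto simp: le_less)
    have l: "quad_lin d i e j = quad_lin d' i' e' j'" using co(2) xx False by simp
    define K where "K = quad_cst d i e j - quad_cst d' i' e' j'"
    have K: "2 * (x * K) = q * q - p * p" using co(3) unfolding xx l K_def
      by (simp add: algebra_simps)
    have "K \<noteq> 0"
    proof
      assume "K = 0"
      then have "quad_cst d i e j = quad_cst d' i' e' j'" by (simp add: K_def)
      then have "(pol A)\<^sup>2 = (pol D)\<^sup>2"
        unfolding A(10) D(10) x_def[symmetric] x'_def[symmetric] xx l by simp
      then show False using ne by simp
    qed
    have "disjoint_labels [A, D, B, C]" using fam by (auto simp: disjoint_labels_def)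
    from disjoint_labels_distinct[OF this A(8,9) D(8,9) dBC(1) B(4) dBC(2) C(4)]
    have dst: "distinct [i, i + d, j, j + e, i', i' + d', j', j' + e']" by simp
    have "2 * (x * \<bar>K\<bar>) > 120"
      unfolding x_def K_def
      using quad_constants_far_apart[OF A(5) lt(1) D(5) lt(2) A(1,3,4,6) D(1,3,4,6) dst _ l] xx \<open>K
        \<noteq> 0\<close>
      unfolding x_def x'_def K_def by simp
    moreover have "2 * (x * \<bar>K\<bar>) = \<bar>q * q - p * p\<bar>"
      using arg_cong[OF K, of abs] \<open>x > 0\<close> by (simp add: abs_mult)
    moreover have "p * p \<le> 11 * 11" "q * q \<le> 11 * 11" using B C by (intro mult_mono; simp)+
    moreover have "1 * 1 \<le> p * p" "1 * 1 \<le> q * q" using B C by (intro mult_mono; simp)+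
    ultimately show False by simp
  qed
qed

text \<open>The leading coefficients of the triples are odd, and a sum of two odd squares is not divisible
  by 4.\<close>

lemma no_relation_3324:
  assumes fam: "disjoint_labels [A, B, C, D]" and eq: "(pol A)\<^sup>2 + (pol B)\<^sup>2
    = (pol C)\<^sup>2 + (pol D)\<^sup>2"
    and len: "length (labs A) = 3" "length (labs B) = 3" "length (labs C) = 2" "length (labs D) = 4"
  shows False
proof -
  have admissible: "admissible A" "admissible B" "admissible C" "admissible D"
    using disjoint_labels_admissible[OF fam] by auto
  obtain i a c where A: "(pol A)\<^sup>2 = [:trip_cst a i c, trip_lin a i c, 4 * (a * a) - 1:]\<^sup>2"
    using trip_shape[OF admissible(1) len(1)] by metis
  obtain j b c' where B: "(pol B)\<^sup>2 = [:trip_cst b j c', trip_lin b j c', 4 * (b * b) - 1:]\<^sup>2"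
    using trip_shape[OF admissible(2) len(2)] by metis
  obtain k q where C: "(pol C)\<^sup>2 = (pair_poly k q)\<^sup>2"
    using pair_shape[OF admissible(3) len(3)] by metis
  have "degree ((pol C)\<^sup>2 + (pol D)\<^sup>2) \<le> 2 * 2"
    unfolding eq[symmetric] A B square_quadratic by simp
  then have "degree (pol D) \<le> 2" by (rule degree_sum_squares)
  then have "degree (pol D) \<le> 3" by simp
  then obtain l d l' e where D: "(pol D)\<^sup>2
    = [:quad_cst d l e l', 4 * quad_lin d l e l', 4 * (d * d - e * e):]\<^sup>2"
    using ordered_quad_shape[OF admissible(4) len(4)] by metis
  define x y z where xyz: "x = a * a" "y = b * b" "z = d * d - e * e"
  have "(4 * x - 1) * (4 * x - 1) + (4 * y - 1) * (4 * y - 1) = 4 * z * (4 * z)"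
    using eq unfolding A B C D square_quadratic pair_poly_square xyz by simp
  then have "16 * (x * x) - 8 * x + 16 * (y * y) - 8 * y + 2 = 16 * (z * z)"
    by (simp add: algebra_simps)
  then show False by presburger
qed

text \<open>The leading coefficients \<open>4a\<^sup>2 - 1\<close> and \<open>4b\<^sup>2 - 1\<close> of the triples have squares that differ by
  \<open>16 (d\<^sup>2 - e\<^sup>2)\<^sup>2\<close>. In the given range this happens only for \<open>a = b\<close>, and then the quadruple is a
  parallelogram.\<close>

lemma no_relation_3234:
  assumes fam: "disjoint_labels [A, B, C, D]" and eq: "(pol A)\<^sup>2 + (pol B)\<^sup>2
    = (pol C)\<^sup>2 + (pol D)\<^sup>2"
    and len: "length (labs A) = 3" "length (labs B) = 2" "length (labs C) = 3" "length (labs D) = 4"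
  shows False
proof -
  have admissible: "admissible A" "admissible B" "admissible C" "admissible D"
    using disjoint_labels_admissible[OF fam] by auto
  obtain i a c where A: "0 \<le> i" "1 \<le> a" "i + a \<le> 11" "0 \<le> c" "c \<le> 11" "distinct [i, i + a, c]"
    "set (labs A) = set [i, i + a, c]"
     "(pol A)\<^sup>2 = [:trip_cst a i c, trip_lin a i c, 4 * (a * a) - 1:]\<^sup>2"
    by (rule trip_shape[OF admissible(1) len(1)])
  obtain j p where B: "0 \<le> j" "1 \<le> p" "j + p \<le> 11" "set (labs B) = set [j, j + p]" "(pol B)\<^sup>2
    = (pair_poly j p)\<^sup>2"
    by (rule pair_shape[OF admissible(2) len(2)])
  obtain k b c' where C: "0 \<le> k" "1 \<le> b" "k + b \<le> 11" "0 \<le> c'" "c' \<le> 11" "distinct [k, k + b, c']"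
    "set (labs C) = set [k, k + b, c']"
     "(pol C)\<^sup>2 = [:trip_cst b k c', trip_lin b k c', 4 * (b * b) - 1:]\<^sup>2"
    by (rule trip_shape[OF admissible(3) len(3)])
  have dB: "distinct [j, j + p]" using B by simp
  have "degree ((pol C)\<^sup>2 + (pol D)\<^sup>2) \<le> 2 * 2"
    unfolding eq[symmetric] A(8) B(5) square_quadratic pair_poly_square by simp
  then have "degree (pol D) \<le> 2" by (rule degree_sum_squares)
  then have "degree (pol D) \<le> 3" by simp
  then obtain l d l' e where D: "0 \<le> l" "1 \<le> d" "l + d \<le> 11" "0 \<le> l'" "1 \<le> e" "l' + e \<le> 11"
    "(pol D)\<^sup>2 = [:quad_cst d l e l', 4 * quad_lin d l e l', 4 * (d * d - e * e):]\<^sup>2"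
    using ordered_quad_shape[OF admissible(4) len(4)] by metis
  define z where "z = d * d - e * e"
  have lead: "(4 * (a * a) - 1) * (4 * (a * a) - 1) - (4 * (b * b) - 1) * (4 * (b * b) - 1)
    = 16 * (z * z)"
    using eq unfolding A(8) B(5) C(8) D(7) z_def[symmetric] square_quadratic pair_poly_square
      by simp
  have "a = b"
  proof (rule ccontr)
    assume "a \<noteq> b"
    with trips_quad_leads_check[unfolded trips_quad_leads_check_def, THEN all_uptoD, of a, THEN
      all_uptoD, of b] A C
    have ck: "all_upto 1 11 (\<lambda>d. all_upto 1 11 (\<lambda>e.
      (4 * (a * a) - 1) * (4 * (a * a) - 1) - (4 * (b * b) - 1) * (4 * (b * b) - 1)
        \<noteq> 16 * ((d * d - e * e) * (d * d - e * e))))" by simp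
    show False
      using ck[THEN all_uptoD, of d, THEN all_uptoD, of e] lead D unfolding z_def by simp
  qed
  then have "d * d - e * e = 0" using lead unfolding z_def by simp
  then have "degree (pol D) \<le> 1"
    using degree_le_1_of_square_quadratic[OF D(7)] by simp
  then obtain m d e where D': "0 \<le> m" "1 \<le> d" "1 \<le> e" "d \<noteq> e" "m + d + e \<le> 11"
    "distinct [m, m + d, m + e, m + d + e]" "set (labs D) = set [m, m + d, m + e, m + d + e]"
    "(pol D)\<^sup>2 = [:4 * (d * d * e) * (2 * m + d + e), 8 * (d * d * e):]\<^sup>2"
    using parallelogram_shape[OF admissible(4) len(4)] by metis
  have "disjoint_labels [A, C, B, D]" using fam by (auto simp: disjoint_labels_def)
  from disjoint_labels_distinct[OF this A(6,7) C(6,7) dB B(4) D'(6,7)]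
  have dst: "distinct [i, i + a, c, k, k + a, c', j, j + p, m, m + d, m + e, m + d + e]"
    unfolding \<open>a = b\<close> by simp
  have co: "(4 * (a * a) - 1) * trip_lin a i c = (4 * (a * a) - 1) * trip_lin a k c'"
    "2 * (trip_cst a i c * (4 * (a * a) - 1)) + trip_lin a i c * trip_lin a i c + 4 * (p * p)
      = 2 * (trip_cst a k c' * (4 * (a * a) - 1)) + trip_lin a k c' * trip_lin a k c' + 64 * ((d *
        d * e) * (d * d * e))"
    using eq unfolding A(8) B(5) C(8) D'(8) square_quadratic pair_poly_square parallelogram_square
      \<open>a = b\<close> by simp_all
  then have l: "trip_lin a i c = trip_lin a k c'" using trip_lead_pos[OF A(2)] by simp
  show False
    using co(2) l C(3) \<open>a = b\<close>
    by (intro trips_pair_parallelogram_differ[OF A(2) B(2) D'(2-4) A(1,3) C(1) _ A(4,5) C(4,5)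
      B(1,3) D'(1,5) dst l]) (simp_all add: ac_simps)
qed

lemma no_relation_3333_ordered:
  assumes fam: "disjoint_labels [A, B, C, D]" and eq: "(pol A)\<^sup>2 + (pol B)\<^sup>2
    = (pol C)\<^sup>2 + (pol D)\<^sup>2"
    and a: "1 \<le> a" "1 \<le> b"
    and A: "0 \<le> i1" "i1 + a \<le> 11" "0 \<le> c1" "c1 \<le> 11" "distinct [i1, i1 + a, c1]" "set (labs A)
      = set [i1, i1 + a, c1]"
      "(pol A)\<^sup>2 = [:trip_cst a i1 c1, trip_lin a i1 c1, 4 * (a * a) - 1:]\<^sup>2"
    and B: "0 \<le> i2" "i2 + b \<le> 11" "0 \<le> c2" "c2 \<le> 11" "distinct [i2, i2 + b, c2]" "set (labs B)
      = set [i2, i2 + b, c2]"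
      "(pol B)\<^sup>2 = [:trip_cst b i2 c2, trip_lin b i2 c2, 4 * (b * b) - 1:]\<^sup>2"
    and C: "0 \<le> i3" "i3 + a \<le> 11" "0 \<le> c3" "c3 \<le> 11" "distinct [i3, i3 + a, c3]" "set (labs C)
      = set [i3, i3 + a, c3]"
      "(pol C)\<^sup>2 = [:trip_cst a i3 c3, trip_lin a i3 c3, 4 * (a * a) - 1:]\<^sup>2"
    and D: "0 \<le> i4" "i4 + b \<le> 11" "0 \<le> c4" "c4 \<le> 11" "distinct [i4, i4 + b, c4]" "set (labs D)
      = set [i4, i4 + b, c4]"
      "(pol D)\<^sup>2 = [:trip_cst b i4 c4, trip_lin b i4 c4, 4 * (b * b) - 1:]\<^sup>2"
  shows False
proof -
  have dst: "distinct [i1, i1 + a, c1, i2, i2 + b, c2, i3, i3 + a, c3, i4, i4 + b, c4]"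
    using disjoint_labels_distinct[OF fam A(5,6) B(5,6) C(5,6) D(5,6)] by simp
  define l l' where "l = 4 * (a * a) - 1" "l' = 4 * (b * b) - 1"
  note ll = this
  have co: "2 * (l * trip_lin a i1 c1) + 2 * (l' * trip_lin b i2 c2)
    = 2 * (l * trip_lin a i3 c3) + 2 * (l' * trip_lin b i4 c4)"
    "2 * (trip_cst a i1 c1 * l) + trip_lin a i1 c1 * trip_lin a i1 c1 + (2 * (trip_cst b i2 c2 *
      l') + trip_lin b i2 c2 * trip_lin b i2 c2)
     = 2 * (trip_cst a i3 c3 * l) + trip_lin a i3 c3 * trip_lin a i3 c3 + (2 * (trip_cst b i4 c4 *
       l') + trip_lin b i4 c4 * trip_lin b i4 c4)"
    "2 * (trip_cst a i1 c1 * trip_lin a i1 c1) + 2 * (trip_cst b i2 c2 * trip_lin b i2 c2)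
     = 2 * (trip_cst a i3 c3 * trip_lin a i3 c3) + 2 * (trip_cst b i4 c4 * trip_lin b i4 c4)"
    using eq unfolding A(7) B(7) C(7) D(7) square_quadratic ll[symmetric] by simp_all
  have cs: "c1 \<in> {0..11}" "c2 \<in> {0..11}" "c3 \<in> {0..11}" "c4 \<in> {0..11}" using A B C D by auto
  have "l * trip_lin a i1 c1 + l' * trip_lin b i2 c2 = l * trip_lin a i3 c3 + l' * trip_lin b i4 c4"
    using co(1) by linarith
  moreover have "2 * (l * trip_cst a i1 c1) + trip_lin a i1 c1 * trip_lin a i1 c1 + (2 * (l' *
    trip_cst b i2 c2) + trip_lin b i2 c2 * trip_lin b i2 c2)
     = 2 * (l * trip_cst a i3 c3) + trip_lin a i3 c3 * trip_lin a i3 c3 + (2 * (l' * trip_cst b i4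
       c4) + trip_lin b i4 c4 * trip_lin b i4 c4)"
    using co(2) by (simp only: mult.commute[of l] mult.commute[of l'])
  moreover have "trip_lin a i1 c1 * trip_cst a i1 c1 + trip_lin b i2 c2 * trip_cst b i2 c2
    = trip_lin a i3 c3 * trip_cst a i3 c3 + trip_lin b i4 c4 * trip_cst b i4 c4"
    using co(3) by (simp add: mult.commute)
  ultimately show False
    unfolding ll by (rule four_trips_differ[OF a A(1,2) B(1,2) C(1,2) D(1,2) cs dst])
qed

text \<open>In the given range the leading coefficients on both sides agree up to order, so the triples on
  opposite sides can be matched by their gaps.\<close>

lemma no_relation_3333:
  assumes fam: "disjoint_labels [A, B, C, D]" and eq: "(pol A)\<^sup>2 + (pol B)\<^sup>2
    = (pol C)\<^sup>2 + (pol D)\<^sup>2"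
    and len: "length (labs A) = 3" "length (labs B) = 3" "length (labs C) = 3" "length (labs D) = 3"
  shows False
proof -
  have admissible: "admissible A" "admissible B" "admissible C" "admissible D"
    using disjoint_labels_admissible[OF fam] by auto
  obtain i1 a1 c1 where A: "0 \<le> i1" "1 \<le> a1" "i1 + a1 \<le> 11" "0 \<le> c1" "c1 \<le> 11"
    "distinct [i1, i1 + a1, c1]" "set (labs A) = set [i1, i1 + a1, c1]"
     "(pol A)\<^sup>2 = [:trip_cst a1 i1 c1, trip_lin a1 i1 c1, 4 * (a1 * a1) - 1:]\<^sup>2"
    by (rule trip_shape[OF admissible(1) len(1)])
  obtain i2 a2 c2 where B: "0 \<le> i2" "1 \<le> a2" "i2 + a2 \<le> 11" "0 \<le> c2" "c2 \<le> 11"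
    "distinct [i2, i2 + a2, c2]" "set (labs B) = set [i2, i2 + a2, c2]"
     "(pol B)\<^sup>2 = [:trip_cst a2 i2 c2, trip_lin a2 i2 c2, 4 * (a2 * a2) - 1:]\<^sup>2"
    by (rule trip_shape[OF admissible(2) len(2)])
  obtain i3 a3 c3 where C: "0 \<le> i3" "1 \<le> a3" "i3 + a3 \<le> 11" "0 \<le> c3" "c3 \<le> 11"
    "distinct [i3, i3 + a3, c3]" "set (labs C) = set [i3, i3 + a3, c3]"
     "(pol C)\<^sup>2 = [:trip_cst a3 i3 c3, trip_lin a3 i3 c3, 4 * (a3 * a3) - 1:]\<^sup>2"
    by (rule trip_shape[OF admissible(3) len(3)])
  obtain i4 a4 c4 where D: "0 \<le> i4" "1 \<le> a4" "i4 + a4 \<le> 11" "0 \<le> c4" "c4 \<le> 11"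
    "distinct [i4, i4 + a4, c4]" "set (labs D) = set [i4, i4 + a4, c4]"
     "(pol D)\<^sup>2 = [:trip_cst a4 i4 c4, trip_lin a4 i4 c4, 4 * (a4 * a4) - 1:]\<^sup>2"
    by (rule trip_shape[OF admissible(4) len(4)])
  have lead: "(4 * (a1 * a1) - 1) * (4 * (a1 * a1) - 1) + (4 * (a2 * a2) - 1) * (4 * (a2 * a2) - 1)
    = (4 * (a3 * a3) - 1) * (4 * (a3 * a3) - 1) + (4 * (a4 * a4) - 1) * (4 * (a4 * a4) - 1)"
    using eq unfolding A(8) B(8) C(8) D(8) square_quadratic by simp
  define F where "F = (4 * (a1 * a1) - 1) * (4 * (a1 * a1) - 1) + (4 * (a2 * a2) - 1) * (4 * (a2 *
    a2) - 1)
    - (4 * (a3 * a3) - 1) * (4 * (a3 * a3) - 1)"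
  have F: "F = (4 * (a4 * a4) - 1) * (4 * (a4 * a4) - 1)" using lead by (simp add: F_def)
  have "if F < 0 then True else all_upto 1 11 (\<lambda>d. if F = (4 * (d * d) - 1) * (4 * (d * d) - 1)
      then a1 = a3 \<and> a2 = d \<or> a1 = d \<and> a2 = a3 else True)"
    using trip_leads_check[unfolded trip_leads_check_def Let_def, THEN all_uptoD, of a1, THEN
      all_uptoD, of a2,
      THEN all_uptoD, of a3] A B C unfolding F_def by simp
  moreover have "\<not> F < 0" unfolding F by (simp add: not_less)
  ultimately have "all_upto 1 11 (\<lambda>d. if F = (4 * (d * d) - 1) * (4 * (d * d) - 1)
      then a1 = a3 \<and> a2 = d \<or> a1 = d \<and> a2 = a3 else True)" by (simp only: if_False)
  from this[THEN all_uptoD, of a4] have "a1 = a3 \<and> a2 = a4 \<or> a1 = a4 \<and> a2 = a3"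
    using F D by (simp only: if_True)
  then show False
  proof
    assume "a1 = a3 \<and> a2 = a4"
    then have "a3 = a1" "a4 = a2" by auto
    show False
      by (rule no_relation_3333_ordered[OF fam eq A(2) B(2) A(1,3-8) B(1,3-8)
        C(1,3-8)[unfolded \<open>a3 = a1\<close>] D(1,3-8)[unfolded \<open>a4 = a2\<close>]])
  next
    assume "a1 = a4 \<and> a2 = a3"
    then have "a4 = a1" "a3 = a2" by auto
    have fam': "disjoint_labels [A, B, D, C]" using fam by (auto simp: disjoint_labels_def)
    have eq': "(pol A)\<^sup>2 + (pol B)\<^sup>2 = (pol D)\<^sup>2 + (pol C)\<^sup>2" using eq by (simp add: add.commute)
    show False
      by (rule no_relation_3333_ordered[OF fam' eq' A(2) B(2) A(1,3-8) B(1,3-8)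
        D(1,3-8)[unfolded \<open>a4 = a1\<close>] C(1,3-8)[unfolded \<open>a3 = a2\<close>]])
  qed
qed

text \<open>The largest tree is placed last; the listed sizes are all partitions of 12 into four parts of
  size at least 2.\<close>

lemma no_four_nonleaf_sorted:
  assumes fam: "disjoint_labels [A, B, C, D]" and eq: "(pol A)\<^sup>2 + (pol B)\<^sup>2
    = (pol C)\<^sup>2 + (pol D)\<^sup>2"
    and ge: "length (labs A) \<ge> 2" "length (labs B) \<ge> 2" "length (labs C) \<ge> 2" "length (labs D) \<ge> 2"
    and sum: "length (labs A) + length (labs B) + length (labs C) + length (labs D) = 12"
    and ord: "length (labs B) \<le> length (labs A)" "length (labs A) \<le> length (labs D)"
      "length (labs C) \<le> length (labs D)"
  shows False
proof -
  define a b c d where "a = length (labs A)" "b = length (labs B)" "c = length (labs C)" "d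
    = length (labs D)"
  note abcd = this
  note facts = ge[folded abcd] sum[folded abcd] ord[folded abcd]
  have "a = 2 \<and> b = 2 \<and> c = 2 \<and> d = 6 \<or> a = 2 \<and> b = 2 \<and> c = 3 \<and> d = 5 \<or> a = 3 \<and> b = 2 \<and> c = 2 \<and> d
    = 5
    \<or> a = 2 \<and> b = 2 \<and> c = 4 \<and> d = 4 \<or> a = 4 \<and> b = 2 \<and> c = 2 \<and> d = 4 \<or> a = 3 \<and> b = 3 \<and> c = 2 \<and> d = 4
    \<or> a = 3 \<and> b = 2 \<and> c = 3 \<and> d = 4 \<or> a = 3 \<and> b = 3 \<and> c = 3 \<and> d = 3"
    using facts by presburger
  then show False
    using no_relation_2226[OF fam eq] no_relation_2235[OF fam eq] no_relation_3225[OF fam eq]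
      no_relation_2244[OF fam eq]
      no_relation_4224[OF fam eq] no_relation_3324[OF fam eq] no_relation_3234[OF fam eq]
        no_relation_3333[OF fam eq]
    unfolding abcd by blast
qed

lemma no_four_nonleaf:
  assumes fam: "disjoint_labels [A, B, C, D]" and eq: "(pol A)\<^sup>2 + (pol B)\<^sup>2
    = (pol C)\<^sup>2 + (pol D)\<^sup>2"
    and ge: "length (labs A) \<ge> 2" "length (labs B) \<ge> 2" "length (labs C) \<ge> 2" "length (labs D) \<ge> 2"
    and sum: "length (labs A) + length (labs B) + length (labs C) + length (labs D) = 12"
  shows False
proof -
  have step: False
    if fam: "disjoint_labels [A, B, C, D]" and eq: "(pol A)\<^sup>2 + (pol B)\<^sup>2 = (pol C)\<^sup>2 + (pol D)\<^sup>2"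
    and ge: "length (labs A) \<ge> 2" "length (labs B) \<ge> 2" "length (labs C) \<ge> 2" "length (labs D) \<ge> 2"
    and sum: "length (labs A) + length (labs B) + length (labs C) + length (labs D) = 12"
    and ord: "length (labs A) \<le> length (labs D)" "length (labs B) \<le> length (labs D)"
      "length (labs C) \<le> length (labs D)"
    for A B C D
  proof (cases "length (labs B) \<le> length (labs A)")
    case True
    then show False using no_four_nonleaf_sorted[OF fam eq] ge sum ord by simp
  next
    case False
    have "disjoint_labels [B, A, C, D]" using fam by (auto simp: disjoint_labels_def)
    moreover have "(pol B)\<^sup>2 + (pol A)\<^sup>2 = (pol C)\<^sup>2 + (pol D)\<^sup>2" using eq
      by (simp add: add.commute)
    ultimately show False using no_four_nonleaf_sorted[of B A C D] ge sum ord False by simp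
  qed
  have perms: "disjoint_labels [A, B, D, C]" "disjoint_labels [C, D, B, A]"
    "disjoint_labels [C, D, A, B]"
    using fam by (auto simp: disjoint_labels_def)
  have eqs: "(pol A)\<^sup>2 + (pol B)\<^sup>2 = (pol D)\<^sup>2 + (pol C)\<^sup>2" "(pol C)\<^sup>2 + (pol D)\<^sup>2
    = (pol B)\<^sup>2 + (pol A)\<^sup>2"
    "(pol C)\<^sup>2 + (pol D)\<^sup>2 = (pol A)\<^sup>2 + (pol B)\<^sup>2" using eq by (simp_all add: add.commute)
  show False
    using step[OF fam eq] step[OF perms(1) eqs(1)] step[OF perms(2) eqs(2)] step[OF perms(3)
      eqs(3)] ge sum
    by (smt (verit) add.commute add.left_commute nat_le_linear order_trans)
qed

section \<open>No zero tree on twelve consecutive integers\<close>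

text \<open>Modulo 2, the coefficient of \<open>x\<^sup>2\<close> in the square of a tree polynomial is its linear coefficient,
  which is odd exactly for leaves. So the number of leaves among the four trees is even.\<close>

lemma no_four_trees:
  assumes fam: "disjoint_labels [E, F, G, H]" and eq: "(pol E)\<^sup>2 + (pol F)\<^sup>2
    = (pol G)\<^sup>2 + (pol H)\<^sup>2"
    and sum: "length (labs E) + length (labs F) + length (labs G) + length (labs H) = 12"
  shows False
proof -
  define e f g h where efgh: "e \<longleftrightarrow> length (labs E) = 1" "f \<longleftrightarrow> length (labs F) = 1"
     "g \<longleftrightarrow> length (labs G) = 1" "h \<longleftrightarrow> length (labs H) = 1"
  have "coeff ((pol E)\<^sup>2) 2 + coeff ((pol F)\<^sup>2) 2 = coeff ((pol G)\<^sup>2) 2 + coeff ((pol H)\<^sup>2) 2"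
    using arg_cong[OF eq, of "\<lambda>p. coeff p 2"] by simp
  then have "even (coeff ((pol E)\<^sup>2) 2 + coeff ((pol F)\<^sup>2) 2) \<longleftrightarrow> even (coeff ((pol G)\<^sup>2) 2 + coeff
    ((pol H)\<^sup>2) 2)"
    by simp
  then have par: "(e = f) = (g = h)"
    by (simp add: coeff_square_2 even_linear_coeff efgh del: One_nat_def)
  have ge: "\<not> e \<Longrightarrow> 2 \<le> length (labs E)" "\<not> f \<Longrightarrow> 2 \<le> length (labs F)"
    "\<not> g \<Longrightarrow> 2 \<le> length (labs G)" "\<not> h \<Longrightarrow> 2 \<le> length (labs H)"
    using length_labs_ge_1[of E] length_labs_ge_1[of F] length_labs_ge_1[of G] length_labs_ge_1[of
      H]
    unfolding efgh by linarith+
  have perms: "disjoint_labels [E, F, H, G]" "disjoint_labels [F, E, G, H]"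
    "disjoint_labels [F, E, H, G]"
    using fam by (auto simp: disjoint_labels_def)
  have eqs: "(pol E)\<^sup>2 + (pol F)\<^sup>2 = (pol H)\<^sup>2 + (pol G)\<^sup>2" "(pol F)\<^sup>2 + (pol E)\<^sup>2
    = (pol G)\<^sup>2 + (pol H)\<^sup>2"
    "(pol F)\<^sup>2 + (pol E)\<^sup>2 = (pol H)\<^sup>2 + (pol G)\<^sup>2" "(pol G)\<^sup>2 + (pol H)\<^sup>2 = (pol E)\<^sup>2 + (pol F)\<^sup>2"
    using eq by (simp_all add: add.commute)
  consider "\<not> e" "\<not> f" "\<not> g" "\<not> h" | "e" "f" "g" "h" | "e" "f" "\<not> g" "\<not> h" | "g" "h" "\<not> e" "\<not> f"
    | "e" "g" "\<not> f" "\<not> h" | "e" "h" "\<not> f" "\<not> g" | "f" "g" "\<not> e" "\<not> h" | "f" "h" "\<not> e" "\<not> g"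
    using par by blast
  then show False
  proof cases
    case 1 then show False using no_four_nonleaf[OF fam eq] ge sum by blast
  next
    case 2 then show False using sum unfolding efgh by simp
  next
    case 3 then show False using no_leaves_same_side[OF eq] unfolding efgh by blast
  next
    case 4 then show False using no_leaves_same_side[OF eqs(4)] unfolding efgh by blast
  next
    case 5 then show False using no_leaves_opposite_sides[OF fam eq] sum unfolding efgh by simp
  next
    case 6 then show False using no_leaves_opposite_sides[OF perms(1) eqs(1)] sum unfolding efgh
      by simp
  next
    case 7 then show False using no_leaves_opposite_sides[OF perms(2) eqs(2)] sum unfolding efgh
      by simp
  next
    case 8 then show False using no_leaves_opposite_sides[OF perms(3) eqs(3)] sum unfolding efgh
      by simp
  qed
qed

text \<open>If \<open>P\<^sup>2 - Q\<^sup>2 = \<plusminus>(R\<^sup>2 - S\<^sup>2)\<close>, moving the negative terms to the other side gives a sum of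
  two squares on either side, for both signs.\<close>

lemma no_zero_tree_12:
  assumes "mset (labs t) = mset_set {0..11}"
  shows "pol t \<noteq> 0"
proof
  assume zero: "pol t = 0"
  have "distinct (labs t)" by (metis assms distinct_upto mset_eq_imp_distinct_iff mset_set_set
    set_upto)
  moreover have "set_mset (mset (labs t)) = {0..11}" "size (mset (labs t)) = 12" unfolding assms
    by simp_all
  ultimately have admissible: "distinct (labs t)" "set (labs t) \<subseteq> {0..11}" "length (labs t) = 12"
    by simp_all
  obtain l r where t: "t = Node l r" using zero by (cases t) auto
  have lr: "(pol l)\<^sup>2 = (pol r)\<^sup>2" using zero unfolding t by simp
  have nl: "length (labs l) \<noteq> 1" "length (labs r) \<noteq> 1"
    using leaf_iff_of_squares_eq[OF lr] admissible(3) unfolding t by auto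
  then obtain A B C D where ABCD: "l = Node A B" "r = Node C D"
    unfolding length_labs_eq_1 by (metis sqtree.exhaust)
  have fam: "disjoint_labels [A, D, C, B]" "disjoint_labels [A, C, D, B]"
    using admissible unfolding t ABCD by (auto simp: disjoint_labels_def)
  have sum: "length (labs A) + length (labs B) + length (labs C) + length (labs D) = 12"
    using admissible unfolding t ABCD by simp
  have "pol l = pol r \<or> pol l = - pol r" using lr by (simp add: power2_eq_iff)
  then show False
  proof
    assume "pol l = pol r"
    then have "(pol A)\<^sup>2 + (pol D)\<^sup>2 = (pol C)\<^sup>2 + (pol B)\<^sup>2"
      unfolding ABCD by (simp add: algebra_simps)
    from no_four_trees[OF fam(1) this] sum show False by simp
  next
    assume "pol l = - pol r"
    then have "(pol A)\<^sup>2 + (pol C)\<^sup>2 = (pol D)\<^sup>2 + (pol B)\<^sup>2"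
      unfolding ABCD by (simp add: algebra_simps)
    from no_four_trees[OF fam(2) this] sum show False by simp
  qed
qed

theorem corollary1p2:
  fixes L :: int
  assumes "L > 0"
  shows "(\<forall>n :: int. reduces_to_zero (mset_set (int_block L n))) \<longleftrightarrow> 12 dvd L \<and> L \<ge> 24"
proof
  assume red: "\<forall>n :: int. reduces_to_zero (mset_set (int_block L n))"
  then have "12 dvd L" using twelve_dvd_length[of L] assms by blast
  moreover have "L \<noteq> 12"
  proof
    assume "L = 12"
    with red have "\<And>n. reduces_to_zero (mset_set (int_block (11 + 1) n))" by simp
    then show False by (rule universal_zero_tree) (use no_zero_tree_12 in blast)
  qed
  ultimately show "12 dvd L \<and> L \<ge> 24" using assms by presburger
next
  assume L: "12 dvd L \<and> L \<ge> 24"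
  then obtain m where "L = 12 * m" by blast
  then have "L = 12 * int (nat m)" "2 \<le> nat m" using L by auto
  then show "\<forall>n. reduces_to_zero (mset_set (int_block L n))" using reduces_blocks_12 by metis
qed

end
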